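(* For every integer $n\ge 27$, the repetitive threshold of an $n$-letter alphabet is $RT(n)=\dfrac{n}{n-1}$.
   Context: For a word $w$, $|w|$ denotes its length. For rational $1<s\le 2$, a fractional $s$-power (a word of exponent $s$) is a non-empty word $w=xx'$ such that $x'$ is the prefix of $x$ of length $(s-1)|x|$. For example, $010$ is a $3/2$-power. A factor of a (finite or infinite) word is a finite block of consecutive letters of it. For an integer $n>1$, the repetitive threshold $RT(n)$ is the infimum of the real numbers $r$ such that there exists an infinite sequence over an alphabet of $n$ letters that contains no factor of exponent greater than $r$. *)

theory Defs
  imports Complex_Main "HOL-Library.Sublist"
begin

text \<open>
  A word is a list, an infinite sequence is a function on \<^typ>\<open>nat\<close>.
  A word may have several exponents, one for each suitable \<open>x\<close>; powers higher than
  squares need no separate treatment, as they contain squares.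
\<close>

definition frac_power :: "rat \<Rightarrow> 'a list \<Rightarrow> bool" where
  "frac_power s w \<longleftrightarrow> 1 < s \<and> s \<le> 2 \<and> w \<noteq> [] \<and>
     (\<exists>x x'. w = x @ x' \<and> prefix x' x \<and> rat_of_nat (length x') = (s - 1) * rat_of_nat (length x))"

definition factor_of :: "'a list \<Rightarrow> (nat \<Rightarrow> 'a) \<Rightarrow> bool" where
  "factor_of w a \<longleftrightarrow> (\<exists>i. w = map a [i..<i + length w])"

definition avoids_above :: "real \<Rightarrow> (nat \<Rightarrow> 'a) \<Rightarrow> bool" where
  "avoids_above r a \<longleftrightarrow> \<not> (\<exists>w s. factor_of w a \<and> frac_power s w \<and> real_of_rat s > r)"

definition RT_set :: "nat \<Rightarrow> real set" where
  "RT_set n = {r. \<exists>a :: nat \<Rightarrow> nat. range a \<subseteq> {..<n} \<and> avoids_above r a}"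

definition RT :: "nat \<Rightarrow> real" where
  "RT n = Inf (RT_set n)"

text \<open>
  The infimum is a genuine one: for a nonempty alphabet \<^term>\<open>RT_set n\<close> is nonempty
  and bounded below.
\<close>

lemma RT_set_nonempty:
  assumes "n > 0"
  shows "RT_set n \<noteq> {}"
proof -
  have "\<not> real_of_rat s > 2" if "frac_power s w" for s and w :: "nat list"
  proof -
    have "s \<le> 2" using that by (simp add: frac_power_def)
    then have "real_of_rat s \<le> real_of_rat 2" by (simp only: of_rat_less_eq)
    then show ?thesis by simp
  qed
  then have "avoids_above 2 (\<lambda>_. 0 :: nat)"
    unfolding avoids_above_def by blast
  then have "2 \<in> RT_set n"
    using assms unfolding RT_set_def by (auto intro!: exI[of _ "\<lambda>_. 0"])
  then show ?thesis by blast
qed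

lemma RT_set_lower_bound:
  assumes "r \<in> RT_set n"
  shows "1 < r"
proof -
  obtain a :: "nat \<Rightarrow> nat" where a: "range a \<subseteq> {..<n}" "avoids_above r a"
    using assms unfolding RT_set_def by blast
  have "finite (range a)" using a(1) finite_subset by blast
  then have "\<not> inj a" using finite_imageD infinite_UNIV_nat by blast
  then obtain i j where ij: "i < j" "a i = a j"
    unfolding inj_def by (metis linorder_neqE_nat)
  define x where "x = map a [i..<j]"
  define s :: rat where "s = 1 + 1 / rat_of_nat (j - i)"
  have len: "length x = j - i" "length (x @ [a j]) = Suc j - i"
    using ij by (auto simp: x_def)
  have "x @ [a j] = map a [i..<Suc j]"
    using ij by (simp add: x_def)
  then have f: "factor_of (x @ [a j]) a"
    unfolding factor_of_def len using ij by (intro exI[of _ i]) simp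
  have "prefix [a j] x"
    using ij by (simp add: x_def upt_conv_Cons)
  then have "frac_power s (x @ [a j])"
    unfolding frac_power_def using ij
    by (intro conjI exI[of _ x] exI[of _ "[a j]"]) (auto simp: s_def len(1))
  then have "real_of_rat s \<le> r"
    using a(2) f unfolding avoids_above_def by force
  moreover have "1 < s" using ij by (simp add: s_def)
  then have "1 < real_of_rat s" by simp
  ultimately show ?thesis by linarith
qed

lemma bdd_below_RT_set: "bdd_below (RT_set n)"
  by (rule bdd_belowI[of _ 1]) (use RT_set_lower_bound in force)

end

theory Submission
  imports Defs "HOL-Number_Theory.Cong"
begin

text \<open>
  Lower bound: if all exponents stay below \<open>n / (n - 1)\<close>, any \<open>n\<close> consecutive letters are
  distinct, so the sequence has period \<open>n\<close> and contains squares.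

  Upper bound: interleave two cyclic streams of \<open>A = n div 2\<close> and \<open>B = n - A\<close> tracks, at even and odd
  positions respectively (for even \<open>n\<close>, once per row of \<open>n + 1\<close> positions two letters of the first
  stream meet). Letters sit on the tracks and return after \<open>n - 1\<close>, \<open>n\<close> or \<open>n + 1\<close> steps, and the
  two streams are in the same relative position only after \<open>P = (n + 1) * A\<close> steps. From time to
  time a kick permutes the letters of two adjacent tracks of each stream in a 4-cycle; the sets of
  four tracks used are pairwise disjoint, and each has one possible kick time per period \<open>P\<close>.

  A repetition of period \<open>p\<close> and excess \<open>k > p / (n - 1)\<close> is impossible. If \<open>P\<close> does not divide \<open>p\<close>,
  long excesses contradict the order of the tracks, and for \<open>p < P\<close> each letter is kicked at most once,
  which leaves a few local configurations to exclude. If \<open>p = q * P\<close>, then the number of kicks of each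
  group within \<open>p\<close> steps must vanish modulo 4. Groups kicked always force \<open>4\<close> to divide \<open>q\<close>,
  groups kicked in every \<open>4 ^ l\<close>-th period then successively force \<open>4 ^ (K - 2)\<close> to divide \<open>q\<close>.
  This makes the excess so long compared with \<open>q\<close> that a last group, kicked according to the lowest
  nonzero ternary digit of the number of the period, forces every power of 3 to divide \<open>q\<close>.
\<close>

section \<open>Arithmetic\<close>

lemma multiple_between:
  fixes a d :: int
  assumes "a dvd d" "\<bar>d\<bar> < 2 * a"
  shows "d = 0 \<or> d = a \<or> d = - a"
proof -
  obtain k where k: "d = a * k" using assms(1) by blast
  have a: "a > 0" using assms(2) by linarith
  have "\<bar>k\<bar> < 2" using assms(2) a unfolding k abs_mult by (simp add: mult.commute[of a])
  then have "k = 0 \<or> k = 1 \<or> k = -1" by linarith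
  then show ?thesis using k by auto
qed

lemma mod_eq_nat_int_dvd:
  fixes x y a :: nat
  assumes "x mod a = y mod a"
  shows "int a dvd int y - int x"
  using assms by (metis mod_eq_dvd_iff of_nat_mod)

lemma mod_add_self_iff: "((x::nat) + q) mod a = x mod a \<longleftrightarrow> a dvd q"
  using cong_add_lcancel_0_nat[of x q a] by (simp add: cong_def dvd_eq_mod_eq_0)

text \<open>As 3 is -1 modulo 4, adding \<open>m + k\<close> to both sides cancels the kick counts:
  a letter that keeps its value through \<open>k\<close> kicks sits on a track whose phase has grown
  by \<open>k\<close>.\<close>

lemma phase_shift:
  fixes u v m k :: nat
  assumes "(u + 3 * m) mod 4 = (v + 3 * (m + k)) mod 4"
  shows "v mod 4 = (u + k) mod 4"
proof -
  have "(u + 3 * m + (m + k)) mod 4 = (v + 3 * (m + k) + (m + k)) mod 4"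
    using assms by (rule mod_add_cong) simp
  moreover have "u + 3 * m + (m + k) = u + k + m * 4" "v + 3 * (m + k) + (m + k) = v + (m + k) * 4"
    by simp_all
  ultimately show ?thesis by (simp only: mod_mult_self1)
qed

text \<open>The two halves of \<open>w\<close>, rounded down and up, add up to
  \<open>w\<close>.\<close>

lemma div2_Suc_div2_inject: "u div 2 = v div 2 \<Longrightarrow> Suc u div 2 = Suc v div 2 \<Longrightarrow> u = v" for u v :: nat
proof -
  have "Suc w div 2 + w div 2 = w" for w :: nat
    by (induction w) auto
  then show "u div 2 = v div 2 \<Longrightarrow> Suc u div 2 = Suc v div 2 \<Longrightarrow> u = v"
    by metis
qed

lemma diff_left_inject: "m - i = m - j \<Longrightarrow> i \<le> m \<Longrightarrow> j \<le> m \<Longrightarrow> i = j" for i j m :: nat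
  by simp

lemma reflect_div2_inject:
  fixes u v k :: nat
  assumes "u < 2 * k" "v < 2 * k" "k - 1 - u div 2 = k - 1 - v div 2"
  shows "u div 2 = v div 2"
proof -
  have "u div 2 < k" "v div 2 < k" using assms by (simp_all add: less_mult_imp_div_less mult.commute)
  then have "u div 2 \<le> k - 1" "v div 2 \<le> k - 1" by simp_all
  with assms(3) show ?thesis by (rule diff_left_inject)
qed

lemma residue_in_interval:
  fixes a m r :: nat
  assumes "r < m"
  obtains i where "a \<le> i" "i < a + m" "i mod m = r"
proof
  define d where "d = (r + m - a mod m) mod m"
  have "a mod m < m" using assms by simp
  then have "a mod m + (r + m - a mod m) = r + m" by linarith
  then have "(a mod m + (r + m - a mod m)) mod m = r" using assms by simp
  then show "(a + d) mod m = r" unfolding d_def by (metis mod_add_left_eq mod_add_right_eq)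
  show "a \<le> a + d" "a + d < a + m" using assms by (simp_all add: d_def)
qed

lemma card_multiples:
  fixes a d m :: nat
  assumes "0 < d"
  shows "card ({i. d dvd i} \<inter> {a..<a + d * m}) = m"
proof -
  \<comment> \<open>\<open>c\<close> is \<open>a / d\<close> rounded up, so the multiples in
    question are \<open>d * j\<close> with \<open>c \<le> j < c + m\<close>.\<close>
  define c where "c = (a + d - 1) div d"
  have c: "c \<le> j \<longleftrightarrow> a \<le> d * j" for j
  proof -
    have "c \<le> j \<longleftrightarrow> a + d - 1 < Suc j * d"
      unfolding c_def using assms by (metis less_Suc_eq_le less_mult_imp_div_less div_less_iff_less_mult)
    also have "\<dots> \<longleftrightarrow> a \<le> d * j" using assms by (auto simp: mult.commute)
    finally show ?thesis .
  qed
  have "j < c + m \<longleftrightarrow> d * j < a + d * m" for j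
  proof (cases "m \<le> j")
    case True
    then obtain z where z: "j = z + m" by (metis add.commute le_Suc_ex)
    show ?thesis using c[of z] by (auto simp: z algebra_simps not_le[symmetric])
  next
    case False
    then have "d * j < d * m" using assms by simp
    then show ?thesis using False by linarith
  qed
  with c have "{i. d dvd i} \<inter> {a..<a + d * m} = (*) d ` {c..<c + m}"
    by (auto elim!: dvdE)
  moreover have "inj_on ((*) d) {c..<c + m}" using assms by (auto intro: inj_onI)
  ultimately show ?thesis by (simp add: card_image)
qed

text \<open>The two windows share all but their end points \<open>i\<close> and
  \<open>i + q\<close>, so their counts differ by at most 1; both being multiples of 4, they
  agree.\<close>

lemma card_Int_shift:
  fixes E :: "nat set"
  assumes "card (E \<inter> {i..<i + q}) mod 4 = 0" "card (E \<inter> {Suc i..<Suc i + q}) mod 4 = 0" "0 < q"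
  shows "i \<in> E \<longleftrightarrow> i + q \<in> E"
proof -
  define c where "c = card (E \<inter> {Suc i..<i + q})"
  have "E \<inter> {i..<i + q} = (if i \<in> E then insert i (E \<inter> {Suc i..<i + q}) else E \<inter> {Suc i..<i + q})"
    using assms(3) by (auto simp: Suc_le_eq order_le_less)
  then have 1: "card (E \<inter> {i..<i + q}) = c + (if i \<in> E then 1 else 0)"
    by (simp add: c_def)
  have "E \<inter> {Suc i..<Suc i + q}
      = (if i + q \<in> E then insert (i + q) (E \<inter> {Suc i..<i + q}) else E \<inter> {Suc i..<i + q})"
    using assms(3) by (auto simp: less_Suc_eq)
  then have 2: "card (E \<inter> {Suc i..<Suc i + q}) = c + (if i + q \<in> E then 1 else 0)"
    by (simp add: c_def)
  show ?thesis
  proof (rule ccontr)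
    assume "\<not> ?thesis"
    then have "c mod 4 = 0 \<and> (c + 1) mod 4 = 0" using assms 1 2 by (auto split: if_splits)
    then show False by presburger
  qed
qed

lemma power3_mult_inject:
  fixes j j' :: nat
  assumes "3 ^ e * j = 3 ^ e' * j'" "j mod 3 \<noteq> 0" "j' mod 3 \<noteq> 0"
  shows "j = j'"
proof -
  have *: "\<not> e < e'" if eq: "3 ^ e * j = 3 ^ e' * j'" "j mod 3 \<noteq> 0" for e e' j j' :: nat
  proof
    assume "e < e'"
    then obtain d where "e' = e + Suc d" using less_imp_Suc_add by auto
    then have "j = 3 * (3 ^ d * j')" using eq(1) by (simp add: power_add)
    then show False using eq(2) by simp
  qed
  have "e = e'" using *[OF assms(1,2)] *[OF assms(1)[symmetric] assms(3)] by simp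
  then show ?thesis using assms(1) by simp
qed

section \<open>The sequence\<close>

datatype track = L nat | R nat

locale dejean =
  fixes n :: nat
  assumes n27: "27 \<le> n"
begin

definition A where "A = n div 2"
definition B where "B = n - A"
text \<open>A row has \<open>B\<close> odd columns, one round of the \<open>R\<close>-tracks, and
  \<open>A + 1\<close> even ones, one round of the \<open>L\<close>-tracks plus one step, which is
  their drift.\<close>

definition W where "W = n + 1"
definition P where "P = W * A"
text \<open>The number of groups. They take the tracks \<open>L 0\<close> to
  \<open>L (2 * K - 1)\<close> and \<open>R 1\<close> to \<open>R (2 * K)\<close>, which leaves at
  least \<open>R 0\<close> and \<open>R (B - 1)\<close> free.\<close>

definition K where "K = (B - 2) div 2"

lemma sizes:
  "W = n + 1" "A + B = n" "n = 2 * A \<or> n = 2 * A + 1" "13 \<le> A" "A \<le> B" "B \<le> A + 1"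
  "2 * K + 2 \<le> B" "B \<le> 2 * K + 3" "6 \<le> K" "0 < P"
  using n27 unfolding A_def B_def W_def K_def P_def by auto

lemma even_sizes: "even n \<Longrightarrow> n = 2 * A" "even n \<Longrightarrow> B = A"
  and odd_sizes: "odd n \<Longrightarrow> n = 2 * A + 1" "odd n \<Longrightarrow> B = A + 1"
  unfolding A_def B_def by (auto elim!: evenE oddE)

lemma WA: "W = 2 * A + 1 \<or> W = 2 * A + 2"
  using sizes by auto

definition row where "row t = t div W"
definition off where "off t = t mod W"

lemma off_less: "off t < W"
  by (simp add: off_def sizes(1))

lemma row_off: "row t * W + off t = t"
  by (simp add: off_def row_def)

lemma row_off_eq:
  assumes "t = r * W + d" "d < W"
  shows "row t = r" "off t = d"
  using assms by (auto simp: row_def off_def)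

lemma add_same_row:
  assumes "off t + k < W"
  shows "off (t + k) = off t + k" "row (t + k) = row t"
proof -
  have "t + k = row t * W + (off t + k)"
    using row_off[of t] by linarith
  from row_off_eq[OF this assms] show "off (t + k) = off t + k" "row (t + k) = row t"
    by simp_all
qed

lemma add_next_row:
  assumes "W \<le> off t + k" "k \<le> W"
  shows "off (t + k) = off t + k - W" "row (t + k) = Suc (row t)"
proof -
  have "t + k = row t * W + W + (off t + k - W)"
    using row_off[of t] assms(1) by linarith
  then have "t + k = Suc (row t) * W + (off t + k - W)"
    by simp
  moreover have "off t + k - W < W"
    using off_less[of t] assms by linarith
  ultimately show "off (t + k) = off t + k - W" "row (t + k) = Suc (row t)"
    using row_off_eq[of "t + k" "Suc (row t)" "off t + k - W"] by simp_all
qed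

text \<open>
  \<open>L u\<close> and \<open>R c\<close> are the tracks of the two streams. Time is cut into rows of \<open>W\<close> positions, in which
  the \<open>R\<close>-tracks have fixed columns, whereas the \<open>L\<close>-tracks advance by one place from row to row.
\<close>

definition trk where
  "trk t = (if even (off t) then L ((row t + off t div 2) mod A) else R (off t div 2))"

text \<open>
  Group \<open>g\<close> consists of two adjacent tracks of each stream. The groups are in opposite orders on
  the two streams, which is what prevents a shift from exchanging the streams.
\<close>

fun grp where
  "grp (L u) = (if u < 2 * K then Some (K - 1 - u div 2) else None)"
| "grp (R c) = (if 1 \<le> c \<and> c \<le> 2 * K then Some ((c - 1) div 2) else None)"

text \<open>
  A kick of a group moves each of its four letters to the track with the next phase modulo 4. It happens
  when the tracks of the group are about to be read in the order of the phases 0, 3, 1, 2, so that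
  the four letters read next last occurred \<open>n\<close>, \<open>n - 1\<close>, \<open>n + 1\<close> and \<open>n\<close> positions before.
\<close>

fun phase :: "track \<Rightarrow> nat" where
  "phase (L u) = u mod 2"
| "phase (R c) = (if odd c then 3 else 2)"

text \<open>
  The time in \<open>{0..<P}\<close> at which the phase 0 track of group \<open>g\<close> is read just before its phase 3
  track; the summand \<open>A\<close> only keeps the subtraction from being truncated.
\<close>

definition T where
  "T g = ((2 * (K - 1 - g) + A - (2 * g + 1)) mod A) * W + (4 * g + 2)"

text \<open>
  Groups 0 and \<open>g2\<close> are kicked in every period. They lie about half a row apart, so that one of their
  tracks occurs among any \<open>A + 2\<close> consecutive positions.
\<close>

definition g2 where "g2 = (A + 4) div 4"

definition trit1 :: "nat \<Rightarrow> bool" where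
  "trit1 i \<longleftrightarrow> (\<exists>e j. i = 3 ^ e * j \<and> j mod 3 = 1)"

text \<open>The set of the periods in which group \<open>g\<close> is kicked.\<close>

definition E :: "nat \<Rightarrow> nat set" where
  "E g = (if g = 0 \<or> g = g2 then UNIV
     else if g = 1 then {i. trit1 i}
     else {i. 4 ^ (if g < g2 then g - 1 else g - 2) dvd i})"

text \<open>A kick at time \<open>\<tau>\<close> already affects position \<open>\<tau>\<close>, so
  the interval is open on the left and closed on the right.\<close>

definition kicks where
  "kicks g s t = {i \<in> E g. s < T g + i * P \<and> T g + i * P \<le> t}"

definition N where "N g t = card {i \<in> E g. T g + i * P \<le> t}"

text \<open>Group \<open>g\<close> owns the letters \<open>4 * g\<close> to
  \<open>4 * g + 3\<close>; the free tracks get distinct letters from \<open>4 * K\<close> to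
  \<open>n - 1\<close>. Adding \<open>3 * N g t\<close> subtracts the number of kicks modulo 4
  without truncation.\<close>

definition x where
  "x t = (case grp (trk t) of
     Some g \<Rightarrow> 4 * g + (phase (trk t) + 3 * N g t) mod 4
   | None \<Rightarrow> (case trk t of L u \<Rightarrow> 2 * K + u | R c \<Rightarrow> if c = 0 then A + 2 * K else A + c))"

lemma trk_L: "trk t = L u \<longleftrightarrow> even (off t) \<and> u = (row t + off t div 2) mod A"
  and trk_R: "trk t = R c \<longleftrightarrow> odd (off t) \<and> c = off t div 2"
  by (auto simp: trk_def)

lemma trk_L_less: "trk t = L u \<Longrightarrow> u < A"
  using sizes(4) by (auto simp: trk_L)

lemma trk_R_less: "trk t = R c \<Longrightarrow> c < B \<and> off t = 2 * c + 1"
  using sizes off_less[of t] by (auto simp: trk_R elim!: oddE)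

lemma grp_less: "grp k = Some g \<Longrightarrow> g < K"
  by (cases k) (auto split: if_splits)

lemma phase_less: "phase k < 4"
  by (cases k) auto

lemma x_Some: "grp (trk t) = Some g \<Longrightarrow> x t = 4 * g + (phase (trk t) + 3 * N g t) mod 4"
  by (simp add: x_def)

lemma x_Some_less: "grp (trk t) = Some g \<Longrightarrow> x t < 4 * K"
  using grp_less[of "trk t" g] mod_less_divisor[of 4 "phase (trk t) + 3 * N g t"] x_Some[of t g]
  by linarith

lemma x_None:
  assumes "grp (trk t) = None"
  obtains u where "trk t = L u" "2 * K \<le> u" "u < A" "x t = 2 * K + u"
  | "trk t = R 0" "x t = A + 2 * K"
  | c where "trk t = R c" "2 * K < c" "c < B" "x t = A + c"
proof (cases "trk t")
  case (L u)
  then have "2 * K \<le> u" using assms by (simp split: if_splits)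
  moreover from this have "x t = 2 * K + u" using L by (simp add: x_def)
  ultimately show ?thesis using that(1) L trk_L_less by blast
next
  case (R c)
  show ?thesis
  proof (cases "c = 0")
    case True
    then show ?thesis using that(2) R by (simp add: x_def)
  next
    case False
    then have "2 * K < c" using assms R by (simp split: if_splits)
    moreover from this have "x t = A + c" using R by (simp add: x_def)
    ultimately show ?thesis using that(3) R trk_R_less by blast
  qed
qed

lemma x_None_bounds:
  assumes "grp (trk t) = None"
  shows "4 * K \<le> x t" "x t < n"
proof -
  have "4 * K \<le> x t \<and> x t < n"
  proof (rule x_None[OF assms])
    show "4 * K \<le> x t \<and> x t < n" if "2 * K \<le> u" "u < A" "x t = 2 * K + u" for u
      using that sizes(2,7) by linarith
    show "4 * K \<le> x t \<and> x t < n" if "x t = A + 2 * K"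
      using that sizes(2,6,7) by linarith
    show "4 * K \<le> x t \<and> x t < n" if "2 * K < c" "c < B" "x t = A + c" for c
      using that sizes(2,6,7) by linarith
  qed
  then show "4 * K \<le> x t" "x t < n" by auto
qed

lemma x_less: "x t < n"
proof (cases "grp (trk t)")
  case None
  then show ?thesis by (rule x_None_bounds)
next
  case (Some g)
  then show ?thesis using x_Some_less[OF Some] sizes(2,6,7) by linarith
qed

lemma x_eqD:
  assumes "x s = x t"
  shows "grp (trk s) = grp (trk t)"
    and "grp (trk s) = None \<Longrightarrow> trk s = trk t"
    and "grp (trk s) = Some g \<Longrightarrow>
      (phase (trk s) + 3 * N g s) mod 4 = (phase (trk t) + 3 * N g t) mod 4"
proof -
  have dv: "x s div 4 = g" "x s mod 4 = (phase (trk s) + 3 * N g s) mod 4"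
    if "grp (trk s) = Some g" for s g
    using that by (simp_all add: x_Some)
  show g: "grp (trk s) = grp (trk t)"
  proof (cases "grp (trk s)")
    case None
    then show ?thesis using assms x_None_bounds(1)[OF None] x_Some_less[of t] by (cases "grp (trk t)") auto
  next
    case (Some g)
    then show ?thesis
      using assms x_None_bounds(1)[of t] x_Some_less[OF Some] dv(1)[of s] dv(1)[of t]
      by (cases "grp (trk t)") auto
  qed
  show "trk s = trk t" if None: "grp (trk s) = None"
  proof -
    have "grp (trk t) = None" using g None by simp
    then show ?thesis
      by (cases rule: x_None; cases rule: x_None[OF None]) (use assms in auto)
  qed
  show "(phase (trk s) + 3 * N g s) mod 4 = (phase (trk t) + 3 * N g t) mod 4"
    if "grp (trk s) = Some g"
    using that assms g dv(2)[of s g] dv(2)[of t g] by simp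
qed

lemma T_less: "g < K \<Longrightarrow> T g < P"
proof -
  assume "g < K"
  then have "4 * g + 2 < W" using sizes by linarith
  moreover have "(2 * (K - 1 - g) + A - (2 * g + 1)) mod A < A" using sizes by simp
  then have "Suc ((2 * (K - 1 - g) + A - (2 * g + 1)) mod A) * W \<le> A * W"
    using mult_le_mono1 by (metis Suc_leI)
  ultimately show ?thesis unfolding T_def P_def by (simp add: mult.commute)
qed

lemma finite_events: "finite {i \<in> X. T g + i * P \<le> t}"
proof -
  have "i \<le> t" if "T g + i * P \<le> t" for i
  proof -
    have "i * 1 \<le> i * P" using sizes(10) by (intro mult_le_mono2) simp
    then show ?thesis using that by linarith
  qed
  then have "{i \<in> X. T g + i * P \<le> t} \<subseteq> {..t}" by auto
  then show ?thesis using finite_subset by auto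
qed

lemma N_add: "N g (t + p) = N g t + card (kicks g t (t + p))"
proof -
  have "{i \<in> E g. T g + i * P \<le> t + p} = {i \<in> E g. T g + i * P \<le> t} \<union> kicks g t (t + p)"
    by (auto simp: kicks_def)
  moreover have "finite (kicks g t (t + p))"
    by (rule finite_subset[OF _ finite_events[of "E g" g "t + p"]]) (auto simp: kicks_def)
  moreover have "{i \<in> E g. T g + i * P \<le> t} \<inter> kicks g t (t + p) = {}"
    by (auto simp: kicks_def)
  ultimately show ?thesis
    unfolding N_def by (simp only: card_Un_disjoint finite_events)
qed

lemma x_eq_phase:
  assumes "x t = x (t + p)" "grp (trk t) = Some g"
  shows "phase (trk (t + p)) mod 4 = (phase (trk t) + card (kicks g t (t + p))) mod 4"
proof -
  have "(phase (trk t) + 3 * N g t) mod 4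
      = (phase (trk (t + p)) + 3 * (N g t + card (kicks g t (t + p)))) mod 4"
    using x_eqD(3)[OF assms] by (simp add: N_add)
  then show ?thesis by (rule phase_shift)
qed

lemma kick_trk:
  assumes "g < K" "\<tau> = T g + i * P"
  shows "off \<tau> = 4 * g + 2"
    "trk \<tau> = L (2 * (K - 1 - g))" "trk (\<tau> + 1) = R (2 * g + 1)"
    "trk (\<tau> + 2) = L (2 * (K - 1 - g) + 1)" "trk (\<tau> + 3) = R (2 * g + 2)"
proof -
  \<comment> \<open>\<open>\<rho>\<close> is the row, modulo \<open>A\<close>, in which column
    \<open>4 * g + 2\<close> carries \<open>L (2 * (K - 1 - g))\<close>.\<close>
  define \<rho> where "\<rho> = (2 * (K - 1 - g) + A - (2 * g + 1)) mod A"
  have g: "4 * g + 6 < W" using assms(1) sizes by linarith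
  have "\<tau> = (\<rho> + i * A) * W + (4 * g + 2)"
    unfolding assms(2) T_def P_def \<rho>_def by (simp add: algebra_simps)
  from row_off_eq[OF this] have ro: "row \<tau> = \<rho> + i * A" "off \<tau> = 4 * g + 2"
    using g by simp_all
  show "off \<tau> = 4 * g + 2" by (fact ro)
  have more: "row (\<tau> + k) = \<rho> + i * A \<and> off (\<tau> + k) = 4 * g + 2 + k" if "k < 4" for k
    using add_same_row[of \<tau> k] ro g that by auto
  have le: "2 * g + 1 \<le> A" "2 * (K - 1 - g) + 1 < A" using assms(1) sizes by linarith+
  have m: "(\<rho> + i * A + (2 * g + 1 + k)) mod A = 2 * (K - 1 - g) + k" if "k \<le> 1" for k
  proof -
    have "(\<rho> + i * A + (2 * g + 1 + k)) mod A
        = (2 * (K - 1 - g) + A - (2 * g + 1) + (2 * g + 1 + k)) mod A"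
      unfolding \<rho>_def by (metis mod_add_left_eq mod_mult_self1)
    also have "2 * (K - 1 - g) + A - (2 * g + 1) + (2 * g + 1 + k) = 2 * (K - 1 - g) + k + A"
      using le by linarith
    also have "\<dots> mod A = 2 * (K - 1 - g) + k" using le that by simp
    finally show ?thesis .
  qed
  show "trk \<tau> = L (2 * (K - 1 - g))" using m[of 0] ro by (simp add: trk_def)
  show "trk (\<tau> + 1) = R (2 * g + 1)" using more[of 1] by (simp add: trk_def)
  show "trk (\<tau> + 2) = L (2 * (K - 1 - g) + 1)"
    using more[of 2] m[of 1] by (simp add: trk_def)
  show "trk (\<tau> + 3) = R (2 * g + 2)" using more[of 3] by (simp add: trk_def)
qed

section \<open>Letters recurring after less than \<open>P\<close> positions\<close>

definition move where
  "move s t \<longleftrightarrow> (\<exists>g i. g < K \<and> i \<in> E g \<and> s < T g + i * P \<and> T g + i * P \<le> t \<and>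
     (trk s = L (2 * (K - 1 - g)) \<and> trk t = L (2 * (K - 1 - g) + 1) \<or>
      trk s = L (2 * (K - 1 - g) + 1) \<and> trk t = R (2 * g + 2) \<or>
      trk s = R (2 * g + 2) \<and> trk t = R (2 * g + 1) \<or>
      trk s = R (2 * g + 1) \<and> trk t = L (2 * (K - 1 - g))))"

definition stay where
  "stay s t \<longleftrightarrow> trk s = trk t \<and>
     (\<forall>g i. grp (trk s) = Some g \<longrightarrow> i \<in> E g \<longrightarrow> \<not> (s < T g + i * P \<and> T g + i * P \<le> t))"

lemma grp_cases:
  assumes "grp k = Some g"
  shows "g < K \<and> (k = L (2 * (K - 1 - g)) \<and> phase k = 0 \<or> k = L (2 * (K - 1 - g) + 1) \<and> phase k = 1
    \<or> k = R (2 * g + 2) \<and> phase k = 2 \<or> k = R (2 * g + 1) \<and> phase k = 3)"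
proof (cases k)
  case (L u)
  then show ?thesis using assms by (cases "even u") (auto split: if_splits elim!: evenE oddE)
next
  case (R c)
  then show ?thesis using assms by (cases "even c") (auto split: if_splits elim!: evenE oddE)
qed

text \<open>Kick times of one group are at least \<open>P\<close> apart, so at most one falls in
  between. The phase then stays or grows by 1, and group and phase determine the track.\<close>

lemma x_eq_short:
  assumes "x t = x (t + p)" "p < P"
  shows "stay t (t + p) \<or> move t (t + p)"
proof (cases "grp (trk t)")
  case None
  then show ?thesis using x_eqD(2)[OF assms(1)] by (simp add: stay_def)
next
  case (Some g)
  have one: "i = j" if "i \<in> kicks g t (t + p)" "j \<in> kicks g t (t + p)" for i j
  proof (rule ccontr)
    assume "i \<noteq> j"
    then have "i + 1 \<le> j \<or> j + 1 \<le> i" by linarith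
    then have "(i + 1) * P \<le> j * P \<or> (j + 1) * P \<le> i * P" using mult_le_mono1 by blast
    then show False using that assms(2) by (auto simp: kicks_def)
  qed
  note ph = x_eq_phase[OF assms(1) Some]
  have g': "grp (trk (t + p)) = Some g" using x_eqD(1)[OF assms(1)] Some by simp
  note gc = grp_cases[OF Some] grp_cases[OF g']
  show ?thesis
  proof (cases "kicks g t (t + p) = {}")
    case True
    then have "phase (trk (t + p)) = phase (trk t)" using ph phase_less by simp
    then have "trk t = trk (t + p)" using gc by auto
    then show ?thesis using True Some by (auto simp: stay_def kicks_def)
  next
    case False
    then obtain i where i: "i \<in> kicks g t (t + p)" by blast
    then have "kicks g t (t + p) = {i}" using one by blast
    then have "phase (trk (t + p)) mod 4 = (phase (trk t) + 1) mod 4" using ph by simp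
    then have "move t (t + p)" unfolding move_def
      using gc i by (intro exI[of _ g] exI[of _ i]) (auto simp: kicks_def)
    then show ?thesis ..
  qed
qed

section \<open>Periods that are not multiples of \<open>P\<close>\<close>

lemma dvd_W_iff: "W dvd p \<longleftrightarrow> off (t + p) = off t"
  by (simp add: off_def mod_add_self_iff)

lemma row_add_W:
  assumes "W dvd p"
  shows "row (t + p) = row t + p div W"
  using assms sizes(1) unfolding row_def by (simp add: div_plus_div_distrib_dvd_right)

lemma L_add_W:
  assumes "W dvd p" "trk t = L u"
  shows "trk (t + p) = L ((u + p div W) mod A)"
proof -
  have o: "off (t + p) = off t" using assms(1) dvd_W_iff by blast
  have u: "u = (row t + off t div 2) mod A" and e: "even (off t)" using assms(2) by (simp_all add: trk_L)
  have "(row t + p div W + off t div 2) mod A = ((row t + off t div 2) + p div W) mod A"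
    by (simp add: ac_simps)
  then show ?thesis using o e unfolding trk_L u row_add_W[OF assms(1)] by (simp add: mod_add_left_eq)
qed

text \<open>Each stream runs through its tracks in order. Only a row end can interfere, and then one
  of the two positions carries the first or the last \<open>R\<close>-track.\<close>

lemma two_later_cases:
  obtains (LL) u where "trk s = L u" "trk (s + 2) = L (Suc u mod A)"
  | (RR) c where "trk s = R c" "trk (s + 2) = R (Suc c)"
  | (last) "trk s = R (B - 1)"
  | (first) "trk (s + 2) = R 0"
proof (cases "off s + 2 < W")
  case True
  note s = add_same_row[OF True]
  show ?thesis
  proof (cases "even (off s)")
    case True
    have "(row s + (off s + 2) div 2) mod A = Suc ((row s + off s div 2) mod A) mod A"
      by (simp add: mod_Suc_eq)
    then show ?thesis using LL True s by (simp add: trk_def)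
  next
    case False
    then show ?thesis using RR s by (simp add: trk_def)
  qed
next
  case False
  then have W: "W \<le> off s + 2" by simp
  have s: "off (s + 2) = off s + 2 - W" "row (s + 2) = Suc (row s)"
    using add_next_row[OF W] sizes(1) n27 by auto
  have "off s = W - 2 \<or> off s = W - 1" using off_less[of s] False by linarith
  then consider "off s = 2 * B - 1" | "off s = W - 1" "W = 2 * A + 1" | "off s = W - 2" "W = 2 * A + 2"
    using WA sizes(1,2) by linarith
  then show ?thesis
  proof cases
    case 1
    have "odd (off s)" "off s div 2 = B - 1" using 1 sizes by auto
    then show ?thesis using last by (simp add: trk_R)
  next
    case 2
    then have "off (s + 2) = 1" using s sizes(4) by simp
    then show ?thesis using first by (simp add: trk_R)
  next
    case 3
    then have "off (s + 2) = 0" "even (off s)" "off s div 2 = A" using s by simp_all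
    then show ?thesis using LL s
      by (simp add: trk_def mod_Suc_eq)
  qed
qed

lemma R_two_later:
  assumes "trk t = R c" "off t + 2 < W"
  shows "trk (t + 2) = R (Suc c)"
  using assms add_same_row[OF assms(2)] by (simp add: trk_R)

lemma L_between:
  assumes "trk t = R c" "off t + 1 < W"
  obtains u where "trk (t + 1) = L u" "off (t + 1) = off t + 1"
  using assms add_same_row[OF assms(2)] that by (auto simp: trk_L trk_R)

text \<open>The part of equality of letters that no kick can disturb, hence usable for periods of
  any length.\<close>

definition sim where
  "sim k k' \<longleftrightarrow> grp k = grp k' \<and> (grp k = None \<longrightarrow> k = k')"

lemma x_eq_sim: "x s = x t \<Longrightarrow> sim (trk s) (trk t)"
  using x_eqD unfolding sim_def by blast

lemma free_R: "c = 0 \<or> c = B - 1 \<Longrightarrow> grp (R c) = None"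
  using sizes(7) by auto

lemma sim_free: "sim k k' \<Longrightarrow> grp k' = None \<Longrightarrow> k = k'"
  unfolding sim_def by metis

lemma sim_free': "sim k k' \<Longrightarrow> grp k = None \<Longrightarrow> k' = k"
  unfolding sim_def by metis

lemma sim_Some: "sim k k' \<Longrightarrow> grp k = Some g \<Longrightarrow> grp k' = Some g"
  unfolding sim_def by metis

lemma grp_L_Some: "grp (L u) = Some g \<longleftrightarrow> u < 2 * K \<and> g = K - 1 - u div 2"
  and grp_R_Some: "grp (R c) = Some g \<longleftrightarrow> 1 \<le> c \<and> c \<le> 2 * K \<and> g = (c - 1) div 2"
  by auto

text \<open>A free track matches only itself; otherwise the groups of \<open>c\<close> and
  \<open>c + 1\<close> are the halves, rounded down, of \<open>c - 1\<close> and \<open>c\<close>,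
  which together determine \<open>c\<close>.\<close>

lemma sim_RR:
  assumes "sim (R c) (R c')" "sim (R (Suc c)) (R (Suc c'))"
  shows "c = c'"
proof (cases "grp (R c)")
  case None
  then show ?thesis using sim_free'[OF assms(1)] by simp
next
  case (Some g)
  note g = Some sim_Some[OF assms(1) Some]
  show ?thesis
  proof (cases "grp (R (Suc c))")
    case None
    then show ?thesis using sim_free'[OF assms(2)] by simp
  next
    case (Some h)
    note h = Some sim_Some[OF assms(2) Some]
    have "(c - 1) div 2 = (c' - 1) div 2" "Suc (c - 1) div 2 = Suc (c' - 1) div 2" "1 \<le> c" "1 \<le> c'"
      using g h unfolding grp_R_Some by simp_all
    then show ?thesis using div2_Suc_div2_inject[of "c - 1" "c' - 1"] by linarith
  qed
qed

lemma Suc_mod_A: "u < 2 * K \<Longrightarrow> Suc u mod A = Suc u"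
  using sizes(6,7) by simp

lemma sim_LL:
  assumes "sim (L u) (L v)" "sim (L (Suc u mod A)) (L (Suc v mod A))"
  shows "u = v"
proof (cases "grp (L u)")
  case None
  then show ?thesis using sim_free'[OF assms(1)] by simp
next
  case (Some g)
  note g = Some sim_Some[OF assms(1) Some]
  then have uv: "u < 2 * K" "v < 2 * K" "K - 1 - u div 2 = K - 1 - v div 2"
    unfolding grp_L_Some by simp_all
  have s: "sim (L (Suc u)) (L (Suc v))" using assms(2) uv Suc_mod_A by simp
  show ?thesis
  proof (cases "grp (L (Suc u))")
    case None
    then show ?thesis using sim_free'[OF s] by simp
  next
    case (Some h)
    then have "Suc u < 2 * K" "Suc v < 2 * K" "K - 1 - Suc u div 2 = K - 1 - Suc v div 2"
      using sim_Some[OF s Some] unfolding grp_L_Some by simp_all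
    then have "Suc u div 2 = Suc v div 2" "u div 2 = v div 2"
      using reflect_div2_inject uv by blast+
    then show ?thesis using div2_Suc_div2_inject by blast
  qed
qed

text \<open>Only grouped tracks can match across the streams. Two steps ahead the group number has
  gone up by 1 on \<open>R\<close>, but cannot have gone up on \<open>L\<close>.\<close>

lemma sim_RRR_LLL:
  assumes "sim (R c) (L u)" "sim (R (Suc c)) (L (Suc u mod A))"
    "sim (R (Suc (Suc c))) (L (Suc (Suc u mod A) mod A))"
  shows False
proof -
  have Some: "\<exists>g. grp (R d) = Some g \<and> grp (L v) = Some g" if "sim (R d) (L v)" for d v
    using sim_free'[OF that] sim_Some[OF that] by (cases "grp (R d)") auto
  obtain g where "grp (R c) = Some g" "grp (L u) = Some g" using Some[OF assms(1)] by blast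
  then have c: "1 \<le> c" "u < 2 * K" "(c - 1) div 2 = K - 1 - u div 2"
    unfolding grp_L_Some grp_R_Some by simp_all
  obtain g1 where "grp (L (Suc u)) = Some g1" using Some[OF assms(2)] Suc_mod_A[OF c(2)] by auto
  then have u1: "Suc u < 2 * K" unfolding grp_L_Some by simp
  obtain g' where "grp (R (Suc (Suc c))) = Some g'" "grp (L (Suc (Suc u))) = Some g'"
    using Some[OF assms(3)] Suc_mod_A[OF c(2)] Suc_mod_A[OF u1] by auto
  then have "Suc c div 2 = K - 1 - Suc (Suc u) div 2"
    unfolding grp_L_Some grp_R_Some by simp
  then have "Suc c div 2 \<le> K - 1 - u div 2" by simp
  moreover have "Suc c div 2 = Suc ((c - 1) div 2)" using c(1) by (cases c) auto
  ultimately show False using c(3) by simp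
qed

lemma sim_R_pair_cases:
  assumes "trk t = R c" "off t + 2 < W" "sim (trk t) (trk s)" "sim (trk (t + 2)) (trk (s + 2))"
  obtains (RR) "trk s = R c" "trk (s + 2) = R (Suc c)"
  | (LL) u where "trk s = L u" "trk (s + 2) = L (Suc u mod A)"
proof -
  have t2: "trk (t + 2) = R (Suc c)" using R_two_later assms(1,2) by blast
  have c: "Suc c < B" using trk_R_less[OF t2] by simp
  show ?thesis
  proof (cases s rule: two_later_cases)
    case (LL u)
    then show ?thesis using that(2) by blast
  next
    case (RR c')
    then have "c = c'" using sim_RR assms(1,3,4) t2 by simp
    then show ?thesis using that(1) RR by simp
  next
    case last
    then have "trk t = R (B - 1)" using sim_free[OF assms(3)] free_R by simp
    then show ?thesis using assms(1) c by simp
  next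
    case first
    then have "trk (t + 2) = R 0" using sim_free[OF assms(4)] free_R by simp
    then show ?thesis using t2 by simp
  qed
qed

text \<open>The window holds three \<open>R\<close>-tracks with two \<open>L\<close>-tracks in
  between. If the first two \<open>R\<close> fall on the \<open>R\<close>-stream, their columns
  agree, so \<open>W\<close> divides \<open>p\<close>, and the two \<open>L\<close> show that their
  drift vanishes modulo \<open>A\<close>. Otherwise all three \<open>R\<close> fall on the
  \<open>L\<close>-stream, against the order of the groups.\<close>

lemma period_dvd:
  assumes "odd (off t)" "off t + 4 < W" "\<And>i. i < 5 \<Longrightarrow> x (t + i) = x (t + i + p)"
  shows "P dvd p"
proof -
  have sm: "sim (trk (t + i)) (trk (t + i + p))" if "i < 5" for i
    using x_eq_sim assms(3) that by blast
  define c where "c = off t div 2"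
  have t0: "trk t = R c" using assms(1) by (simp add: trk_R c_def)
  have t2: "trk (t + 2) = R (Suc c)" using R_two_later[OF t0] assms(2) by simp
  have o2: "off (t + 2) = off t + 2" using add_same_row[of t 2] assms(2) by simp
  have t4: "trk (t + 2 + 2) = R (Suc (Suc c))" using R_two_later[OF t2] assms(2) o2 by simp
  have s0: "sim (trk t) (trk (t + p))" "sim (trk (t + 2)) (trk (t + p + 2))"
    "sim (trk (t + 2)) (trk (t + 2 + p))" "sim (trk (t + 2 + 2)) (trk (t + 2 + p + 2))"
  proof -
    have e: "t + p + 2 = t + 2 + p" "t + 2 + 2 = t + 4" "t + 2 + p + 2 = t + 4 + p" by simp_all
    show "sim (trk t) (trk (t + p))" using sm[of 0] by simp
    show "sim (trk (t + 2)) (trk (t + p + 2))" "sim (trk (t + 2)) (trk (t + 2 + p))"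
      "sim (trk (t + 2 + 2)) (trk (t + 2 + p + 2))"
      unfolding e using sm[of 2] sm[of 4] by simp_all
  qed
  have first: "off t + 2 < W" and second: "off (t + 2) + 2 < W" using assms(2) o2 by simp_all
  show ?thesis
  proof (rule sim_R_pair_cases[OF t0 first s0(1,2)])
    assume "trk (t + p) = R c"
    then have "off (t + p) = off t" using t0 trk_R_less by metis
    then have Wp: "W dvd p" using dvd_W_iff by blast
    obtain u where u: "trk (t + 1) = L u" using L_between[OF t0] assms(2) by auto
    have "trk (t + 1 + 2) = L (Suc u mod A)"
    proof (cases "t + 1" rule: two_later_cases)
      case first
      have "off (t + 3) = off t + 3" using add_same_row[of t 3] assms(2) by simp
      moreover have "t + 1 + 2 = t + 3" by simp
      ultimately have "off (t + 1 + 2) = off t + 3" by (simp only:)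
      then show ?thesis using first assms(1) by (simp add: trk_R)
    qed (use u in simp_all)
    moreover have "t + 1 + 2 = t + 3" by simp
    ultimately have t3: "trk (t + 3) = L (Suc u mod A)" by (simp only:)
    note L = L_add_W[OF Wp u] L_add_W[OF Wp t3]
    have "(Suc u mod A + p div W) mod A = Suc ((u + p div W) mod A) mod A"
      by (simp add: mod_add_left_eq mod_Suc_eq)
    moreover have "sim (L u) (L ((u + p div W) mod A))"
      using sm[of 1] unfolding L u by simp
    moreover have "sim (L (Suc u mod A)) (L ((Suc u mod A + p div W) mod A))"
      using sm[of 3] unfolding L t3 by simp
    ultimately have "u = (u + p div W) mod A" using sim_LL by simp
    then have "A dvd p div W" using mod_add_self_iff trk_L_less[OF u] mod_less by metis
    then show "P dvd p" using Wp unfolding P_def by (simp add: dvd_div_iff_mult mult.commute sizes(1))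
  next
    fix u assume u: "trk (t + p) = L u" "trk (t + p + 2) = L (Suc u mod A)"
    show "P dvd p"
    proof (rule sim_R_pair_cases[OF t2 second s0(3,4)])
      assume "trk (t + 2 + p) = R (Suc c)"
      moreover have e: "t + p + 2 = t + 2 + p" by simp
      ultimately show ?thesis using u(2) unfolding e by simp
    next
      fix v assume v: "trk (t + 2 + p) = L v" "trk (t + 2 + p + 2) = L (Suc v mod A)"
      have e: "t + p + 2 = t + 2 + p" by simp
      have "v = Suc u mod A" using u(2) v(1) unfolding e by simp
      then have False
        using sim_RRR_LLL[of c u] s0(1,3,4) unfolding t0 t2 t4 u(1) v by simp
      then show ?thesis ..
    qed
  qed
qed

section \<open>Periods from \<open>2 * n - 2\<close> up to \<open>P\<close>\<close>

definition step where
  "step k k' \<longleftrightarrow> k = k' \<or> (\<exists>g<K.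
     k = L (2 * (K - 1 - g)) \<and> k' = L (2 * (K - 1 - g) + 1) \<or>
     k = L (2 * (K - 1 - g) + 1) \<and> k' = R (2 * g + 2) \<or>
     k = R (2 * g + 2) \<and> k' = R (2 * g + 1) \<or>
     k = R (2 * g + 1) \<and> k' = L (2 * (K - 1 - g)))"

text \<open>\<open>step\<close> keeps only the two tracks of \<open>stay\<close> or
  \<open>move\<close> and forgets the time of the kick.\<close>

lemma x_eq_step: "x t = x (t + p) \<Longrightarrow> p < P \<Longrightarrow> step (trk t) (trk (t + p))"
  using x_eq_short[of t p] unfolding stay_def move_def step_def by blast

lemma step_simps:
  "step (R c) (R c') \<Longrightarrow> c' = c \<or> even c \<and> c = Suc c'"
  "step (R c) (L u) \<Longrightarrow> odd c"
  "step (L u) (R c) \<Longrightarrow> odd u"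
  "step (L u) (L v) \<Longrightarrow> v = u \<or> even u \<and> v = Suc u \<and> v < A"
  using sizes(6,7) by (auto simp: step_def)

lemma step_free_R:
  assumes "c = 0 \<or> c = B - 1"
  shows "step (R c) k \<Longrightarrow> k = R c" "step k (R c) \<Longrightarrow> k = R c"
  using assms sizes(7) by (auto simp: step_def)

text \<open>After \<open>q\<close> rows the track has advanced by \<open>q\<close> modulo
  \<open>A\<close>, where \<open>1 < q < A\<close> by the bounds on \<open>p\<close>; a step between
  \<open>L\<close>-tracks advances by 0 or 1.\<close>

lemma not_step_L:
  assumes "W dvd p" "2 * n - 2 \<le> p" "p < P" "trk t = L u"
  shows "\<not> step (trk t) (trk (t + p))"
proof
  define q where "q = p div W"
  have pq: "p = q * W" using assms(1) by (simp add: q_def)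
  have "q < A" using assms(3) unfolding pq P_def by (simp add: mult.commute)
  moreover have "1 < q"
  proof (rule ccontr)
    assume "\<not> 1 < q"
    then have "p \<le> 1 * W" unfolding pq by (intro mult_le_mono1) simp
    then show False using assms(2) n27 sizes(1) by simp
  qed
  moreover assume "step (trk t) (trk (t + p))"
  then have "(u + q) mod A = u \<or> (u + q) mod A = Suc u \<and> Suc u < A"
    using step_simps(4) L_add_W[OF assms(1,4)] assms(4) unfolding q_def by force
  then have "(u + q) mod A = u mod A \<or> (Suc u + (q - 1)) mod A = Suc u mod A"
    using trk_L_less[OF assms(4)] \<open>1 < q\<close> by auto
  then have "A dvd q \<or> A dvd q - 1" by (simp only: mod_add_self_iff)
  ultimately show False by (auto dest: dvd_imp_le)
qed

text \<open>The free track fixes the column, so \<open>W\<close> divides \<open>p\<close>, which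
  excludes a step from any \<open>L\<close>-track.\<close>

lemma not_step_free_R:
  assumes "2 * n - 2 \<le> p" "p < P" "trk s = R c" "c = 0 \<or> c = B - 1" "trk t = L u"
    "step (trk s) (trk (s + p))" "step (trk t) (trk (t + p))"
  shows False
proof -
  have "trk (s + p) = R c" using step_free_R(1)[OF assms(4)] assms(3,6) by simp
  then have "off (s + p) = off s" using assms(3) trk_R_less by metis
  then show False using not_step_L[OF _ assms(1,2,5)] assms(7) dvd_W_iff by blast
qed

text \<open>Only an odd \<open>R\<close>-track can step to \<open>L\<close>, and only an even one to
  another \<open>R\<close>-track. Two adjacent ones can thus only stay, so \<open>W\<close> divides
  \<open>p\<close>, which the \<open>L\<close> in between excludes.\<close>

lemma not_step_RLR:
  assumes p: "2 * n - 2 \<le> p" "p < P" and t: "odd (off t)" "off t + 2 < W"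
    and s: "step (trk t) (trk (t + p))" "step (trk (t + 1)) (trk (t + 1 + p))"
      "step (trk (t + 2)) (trk (t + p + 2))"
  shows False
proof -
  define c where "c = off t div 2"
  have t0: "trk t = R c" using t(1) by (simp add: trk_R c_def)
  have t2: "trk (t + 2) = R (Suc c)" using R_two_later[OF t0 t(2)] .
  have c: "Suc c < B" using trk_R_less[OF t2] by simp
  obtain u where u: "trk (t + 1) = L u" using L_between[OF t0] t(2) by auto
  show False
  proof (cases "t + p" rule: two_later_cases)
    case (LL v)
    have "odd c" using step_simps(2)[of c v] s(1) unfolding LL t0 by simp
    moreover have "odd (Suc c)" using step_simps(2)[of "Suc c"] s(3) unfolding LL t2 by blast
    ultimately show ?thesis by simp
  next
    case (RR c')
    have "c' = c \<or> even c \<and> c = Suc c'" "Suc c' = Suc c \<or> even (Suc c) \<and> Suc c = Suc (Suc c')"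
      using step_simps(1) s(1,3) unfolding RR t0 t2 by blast+
    then have "c' = c" by auto
    then have "off (t + p) = off t" using RR t0 trk_R_less by metis
    then show ?thesis using not_step_L[OF _ p u] s(2) dvd_W_iff by blast
  next
    case last
    then show ?thesis using step_free_R(2)[of "B - 1" "trk t"] s(1) t0 c by simp
  next
    case first
    then show ?thesis using step_free_R(2)[of 0 "trk (t + 2)"] s(3) t2 by simp
  qed
qed

text \<open>Windows beginning on \<open>R\<close> fall under \<open>not_step_RLR\<close>; those
  touching a row end contain a free \<open>R\<close>-track next to an
  \<open>L\<close>-track.\<close>

lemma step_window:
  assumes p: "2 * n - 2 \<le> p" "p < P"
    and s: "\<And>i. i < 3 \<Longrightarrow> step (trk (t + i)) (trk (t + i + p))"
  shows "even (off t)" "2 \<le> off t" "off t + 3 < W"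
proof -
  have s': "step (trk t) (trk (t + p))" "step (trk (t + 1)) (trk (t + 1 + p))"
    "step (trk (t + 2)) (trk (t + 2 + p))" "step (trk (t + 2)) (trk (t + p + 2))"
  proof -
    have e: "t + p + 2 = t + 2 + p" by simp
    show "step (trk t) (trk (t + p))" using s[of 0] by simp
    show "step (trk (t + 1)) (trk (t + 1 + p))" using s[of 1] by simp
    show "step (trk (t + 2)) (trk (t + 2 + p))" "step (trk (t + 2)) (trk (t + p + 2))"
      unfolding e using s[of 2] by simp_all
  qed
  have last: "off s \<noteq> n - 1" if "step (trk s) (trk (s + p))" "step (trk (s + 1)) (trk (s + 1 + p))" for s
  proof
    assume o: "off s = n - 1"
    then have o1: "off (s + 1) = n" using add_same_row[of s 1] sizes(1) n27 by simp
    show False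
    proof (cases "even n")
      case True
      then have n1: "n - 1 = 2 * (A - 1) + 1" using even_sizes(1) sizes(4) by linarith
      have "odd (n - 1)" "B - 1 = (n - 1) div 2" unfolding n1 even_sizes(2)[OF True] by simp_all
      then have "trk s = R (B - 1)" using o by (simp add: trk_R)
      moreover obtain u where "trk (s + 1) = L u" using True o1 by (simp add: trk_L)
      ultimately show ?thesis using not_step_free_R[OF p] that by blast
    next
      case False
      then have "odd n" "B - 1 = n div 2" using odd_sizes(2) by (simp_all add: A_def)
      then have "trk (s + 1) = R (B - 1)" using o1 by (simp add: trk_R)
      moreover obtain u where "trk s = L u" using False o n27 by (simp add: trk_L)
      ultimately show ?thesis using not_step_free_R[OF p] that by blast
    qed
  qed
  have first: "off s \<noteq> 0" if "step (trk s) (trk (s + p))" "step (trk (s + 1)) (trk (s + 1 + p))" for s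
  proof
    assume o: "off s = 0"
    then have "off (s + 1) = 1" using add_same_row[of s 1] sizes(1) n27 by simp
    then have "trk (s + 1) = R 0" by (simp add: trk_R)
    moreover obtain u where "trk s = L u" using o by (simp add: trk_L)
    ultimately show False using not_step_free_R[OF p] that by blast
  qed
  have n1: "off t \<noteq> 0" "off t \<noteq> n - 1" using first[of t] last[of t] s' by auto
  have n2: "off (t + 1) \<noteq> 0" "off (t + 1) \<noteq> n - 1"
    using first[of "t + 1"] last[of "t + 1"] s' by (auto simp: ac_simps)
  have lt: "off t + 3 < W"
  proof (rule ccontr)
    assume "\<not> off t + 3 < W"
    then consider "off t = n" | "off t = n - 1" | "off t = n - 2"
      using off_less[of t] sizes(1) by linarith
    then show False
    proof cases
      case 1
      then have "off (t + 1) = 0" using add_next_row[of t 1] sizes(1) by simp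
      then show ?thesis using n2 by simp
    next
      case 2
      then show ?thesis using n1 by simp
    next
      case 3
      then have "off (t + 1) = n - 1" using add_same_row[of t 1] sizes(1) n27 by simp
      then show ?thesis using n2 by simp
    qed
  qed
  then show "off t + 3 < W" .
  show "even (off t)" using not_step_RLR[OF p, of t] lt s' by auto
  then show "2 \<le> off t" using n1(1) by (auto elim!: evenE)
qed

text \<open>If the middle \<open>R\<close> stays, \<open>W\<close> divides \<open>p\<close>. If it
  drops by one track, both \<open>L\<close> would step to the next \<open>L\<close>-track, possible
  only from even tracks. If it goes to an \<open>L\<close>-track, both \<open>L\<close> go to
  \<open>R\<close>-tracks, possible only from odd tracks.\<close>

lemma not_step_LRL:
  assumes p: "2 * n - 2 \<le> p" "p \<le> 3 * n - 4" "p < P"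
    and s: "\<And>i. i < 3 \<Longrightarrow> step (trk (t + i)) (trk (t + i + p))"
  shows False
proof -
  note w = step_window[OF p(1,3) s]
  have off12: "off (t + 1) = off t + 1" "off (t + 2) = off t + 2"
    using add_same_row[of t 1] add_same_row[of t 2] w(3) by auto
  define c where "c = off t div 2"
  define u where "u = (row t + off t div 2) mod A"
  have t0: "trk t = L u" using w(1) by (simp add: trk_L u_def)
  have t1: "trk (t + 1) = R c" using off12 w(1) by (simp add: trk_R c_def)
  have t2: "trk (t + 2) = L (Suc u mod A)"
  proof (cases t rule: two_later_cases)
    case first
    then show ?thesis using off12 w(1) by (simp add: trk_R)
  qed (use t0 in simp_all)
  have s': "step (trk t) (trk (t + p))" "step (trk (t + 1)) (trk (t + 1 + p))"
    "step (trk (t + 2)) (trk (t + p + 2))" "step (trk (t + 2)) (trk (t + 2 + p))"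
  proof -
    have e: "t + p + 2 = t + 2 + p" by simp
    show "step (trk t) (trk (t + p))" using s[of 0] by simp
    show "step (trk (t + 1)) (trk (t + 1 + p))" using s[of 1] by simp
    show "step (trk (t + 2)) (trk (t + 2 + p))" "step (trk (t + 2)) (trk (t + p + 2))"
      unfolding e using s[of 2] by simp_all
  qed
  show False
  proof (cases "trk (t + 1 + p)")
    case (R c')
    then have "c' = c \<or> even c \<and> c = Suc c'" using s'(2) t1 step_simps(1) by simp
    then show False
    proof
      assume "c' = c"
      then have "off (t + 1 + p) = off (t + 1)" using t1 R trk_R_less by metis
      then show False using not_step_L[OF _ p(1,3) t0] s'(1) dvd_W_iff by blast
    next
      assume cc: "even c \<and> c = Suc c'"
      have o: "off (t + 1 + p) + 2 = off (t + 1)" using trk_R_less[OF t1] trk_R_less[OF R] cc by simp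
      then have "off (t + 1 + p + 2) = off (t + 1)"
        using add_same_row[of "t + 1 + p" 2] off_less[of "t + 1"] by simp
      moreover have "t + 1 + p + 2 = t + 1 + (p + 2)" by simp
      ultimately have "off (t + 1 + (p + 2)) = off (t + 1)" by (simp only:)
      then have Wp: "W dvd p + 2" using dvd_W_iff by blast
      define q where "q = (p + 2) div W"
      have pq: "p + 2 = q * W" using Wp by (simp add: q_def)
      \<comment> \<open>The bounds on \<open>p\<close> leave only this multiple of
        \<open>W\<close>.\<close>
      have "q = 2"
      proof -
        have "1 < q"
        proof (rule ccontr)
          assume "\<not> 1 < q"
          then have "p + 2 \<le> 1 * W" unfolding pq by (intro mult_le_mono1) simp
          then show False using p(1) n27 sizes(1) by simp
        qed
        moreover have "q < 3"
        proof (rule ccontr)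
          assume "\<not> q < 3"
          then have "3 * W \<le> p + 2" unfolding pq by (intro mult_le_mono1) simp
          then show False using p(2) n27 sizes(1) by simp
        qed
        ultimately show ?thesis by simp
      qed
      have "trk (t + (p + 2)) = L ((u + 2) mod A)" using L_add_W[OF Wp t0] \<open>q = 2\<close> q_def by simp
      moreover have "t + (p + 2) = t + p + 2" by simp
      ultimately have l2: "trk (t + p + 2) = L ((u + 2) mod A)" by (simp only:)
      obtain v where v: "trk (t + p) = L v" "(u + 2) mod A = Suc v mod A"
      proof (cases "t + p" rule: two_later_cases)
        case (LL v)
        then show ?thesis using that[of v] l2 by simp
      next
        case last
        then show ?thesis using step_free_R(2)[of "B - 1" "trk t"] s'(1) t0 by simp
      qed (use l2 in simp_all)
      have lt: "u < A" "v < A" using trk_L_less t0 v by auto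
      have "v = u \<or> even u \<and> v = Suc u"
        using step_simps(4) s'(1) unfolding t0 v(1) by blast
      moreover have "(u + 2) mod A = Suc u mod A
          \<or> even (Suc u mod A) \<and> (u + 2) mod A = Suc (Suc u mod A)"
        using step_simps(4) s'(3) unfolding t2 l2 by blast
      moreover have "v \<noteq> u"
        using v(2) lt sizes(4) by (auto simp: mod_Suc split: if_splits)
      moreover have "(u + 2) mod A \<noteq> Suc u mod A"
        using lt sizes(4) by (auto simp: mod_Suc split: if_splits)
      moreover have "Suc u mod A = Suc u" if "v = Suc u" using that lt by simp
      ultimately show False by auto
    qed
  next
    case (L v)
    have "t + p + 1 = t + 1 + p" by simp
    then have L': "trk (t + p + 1) = L v" using L by (simp only:)
    \<comment> \<open>If \<open>Suc u\<close> wraps around, the next track is 0, which is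
      even.\<close>
    have parity: "\<not> odd u \<or> \<not> odd (Suc u mod A)"
      using mod_less[of "Suc u" A] by (cases "Suc u = A") (use trk_L_less[OF t0] in auto)
    have LL: "\<not> (odd (off (t + p)) \<and> odd (off (t + p + 2)))"
    proof
      assume "odd (off (t + p)) \<and> odd (off (t + p + 2))"
      then obtain d d' where "trk (t + p) = R d" "trk (t + p + 2) = R d'" by (simp add: trk_R)
      then show False using parity step_simps(3) s'(1,3) unfolding t0 t2 by metis
    qed
    have R0: "trk (t + p + 2) \<noteq> R 0" "trk (t + p) \<noteq> R (B - 1)"
      using s'(1,3) t0 t2 step_free_R(2)[of 0 "trk (t + 2)"] step_free_R(2)[of "B - 1" "trk t"] by auto
    have e: "even (off (t + p + 1))" using L' by (simp add: trk_L)
    show False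
    proof (cases "off (t + p) + 2 < W")
      case True
      then have "off (t + p + 1) = off (t + p) + 1" "off (t + p + 2) = off (t + p) + 2"
        using add_same_row[of "t + p" 1] add_same_row[of "t + p" 2] by simp_all
      then show False using LL e by simp
    next
      case False
      \<comment> \<open>At a row end one neighbour of the \<open>L\<close>-position is
        \<open>R 0\<close> or \<open>R (B - 1)\<close>, which no other track steps to.\<close>
      then consider "off (t + p) = W - 1" | "off (t + p) = W - 2" using off_less[of "t + p"] by linarith
      then show False
      proof cases
        case 1
        then have "off (t + p + 2) = 1" using add_next_row[of "t + p" 2] sizes(1) n27 by simp
        then show False using R0 by (simp add: trk_R)
      next
        case 2
        then have o1: "off (t + p + 1) = W - 1" using add_same_row[of "t + p" 1] sizes(1) n27 by simp
        then have "W = 2 * A + 1" using e WA by auto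
        then have "B = A" "off (t + p) = 2 * (A - 1) + 1" using 2 sizes(1,2,4) by linarith+
        then have "trk (t + p) = R (B - 1)" by (simp add: trk_R)
        then show False using R0 by simp
      qed
    qed
  qed
qed

section \<open>Periods up to \<open>2 * n - 3\<close>\<close>

lemma L_recurs:
  assumes "trk t = L u" "trk (t + p) = L u" "0 < p" "p \<le> 2 * n - 3"
  shows "p = n - 1 \<and> 2 \<le> off t \<or> p = 2 * A \<and> off t = 0"
proof -
  have "even (off t)" "even (off (t + p))" using assms(1,2) by (auto simp: trk_L)
  then obtain m m' where o: "off t = 2 * m" "off (t + p) = 2 * m'" by (auto elim!: evenE)
  obtain r r' where d: "row t = r" "row (t + p) = r'" by simp
  have A: "int n \<le> 2 * int A + 1" "2 * int A \<le> int n" "13 \<le> int A" using sizes(3,4) by linarith+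
  have m: "m \<le> A" "m' \<le> A" using off_less[of t] off_less[of "t + p"] o sizes(1,3) by linarith+
  then have mA: "int m \<le> int A" "int m' \<le> int A" by simp_all
  have W: "int W = int n + 1" using sizes(1) by simp
  have p2: "int p \<le> 2 * int n - 3" using assms(4) n27 by linarith
  have tp: "t = r * W + 2 * m" "t + p = r' * W + 2 * m'"
    using row_off[of t] row_off[of "t + p"] unfolding o d by simp_all
  then have "r' * W + 2 * m' = r * W + 2 * m + p" by linarith
  then have "int (r' * W + 2 * m') = int (r * W + 2 * m + p)" by (simp only:)
  then have p: "int r' * int W + 2 * int m' = int r * int W + 2 * int m + int p" by simp
  \<comment> \<open>Rows and half-columns together advance by a multiple of \<open>A\<close>. In the
    same row this means the first and the last even column; in the next row, two columns to the
    left, so \<open>n - 1\<close> steps; two rows on, at least \<open>2 * n - 2\<close>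
    steps.\<close>
  have "(r + m) mod A = (r' + m') mod A" using assms(1,2) by (simp add: trk_L o d)
  then have "int A dvd int (r' + m') - int (r + m)" by (rule mod_eq_nat_int_dvd)
  then have dvd: "int A dvd int r' + int m' - int r - int m" by (simp add: algebra_simps)
  have "r \<le> r'" unfolding d[symmetric] row_def by (intro div_le_mono) simp
  moreover have "r' \<le> r + 2"
  proof (rule ccontr)
    assume "\<not> r' \<le> r + 2"
    then have "(r + 3) * W \<le> r' * W" by (intro mult_le_mono1) simp
    then have "(r + 3) * W \<le> t + p" using tp(2) by linarith
    then have "r * W + 3 * W \<le> t + p" by (simp add: algebra_simps)
    then show False using tp(1) o off_less[of t] assms(4) sizes(1) by linarith
  qed
  ultimately consider "r' = r" | "r' = r + 1" | "r' = r + 2" by linarith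
  then show ?thesis
  proof cases
    case 1
    then have "int m' - int m = 0 \<or> int m' - int m = int A \<or> int m' - int m = - int A"
      using m A dvd by (intro multiple_between) auto
    then show ?thesis using p 1 assms(3) m o by auto
  next
    case 2
    then have "int m' - int m + 1 = 0 \<or> int m' - int m + 1 = int A \<or> int m' - int m + 1 = - int A"
      using m A dvd by (intro multiple_between) (auto simp: algebra_simps)
    moreover have e: "int p = int W + 2 * int m' - 2 * int m" using p 2 by (simp add: algebra_simps)
    ultimately have "int m' - int m + 1 = 0"
      using p2 mA A W by (elim disjE) linarith+
    then have "p = n - 1" "2 \<le> off t" using e W o by linarith+
    then show ?thesis by blast
  next
    case 3
    then have "int m' - int m + 2 = 0 \<or> int m' - int m + 2 = int A \<or> int m' - int m + 2 = - int A"
      using m A dvd by (intro multiple_between) (auto simp: algebra_simps)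
    moreover have e: "int p = 2 * int W + 2 * int m' - 2 * int m" using p 3 by (simp add: algebra_simps)
    ultimately have False using p2 mA A W by (elim disjE) linarith+
    then show ?thesis ..
  qed
qed

lemma R_recurs:
  assumes "trk t = R c" "trk (t + p) = R c" "0 < p" "p < 2 * W"
  shows "p = W"
proof -
  have "off (t + p) = off t" using assms(1,2) trk_R_less by metis
  then obtain k where k: "p = W * k" using dvd_W_iff by blast
  then have "k = 1" using assms(3,4) by (cases k) auto
  then show ?thesis using k by simp
qed

lemma trk_recurs:
  assumes "trk t = trk (t + p)" "0 < p"
  shows "n - 1 \<le> p"
proof (cases "trk t")
  case (L u)
  then have "trk (t + p) = L u" using assms(1) by simp
  then have "p \<le> 2 * n - 3 \<Longrightarrow> p = n - 1 \<or> p = 2 * A"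
    using L_recurs[OF L _ assms(2)] by blast
  then show ?thesis using n27 sizes(3) by (cases "p \<le> 2 * n - 3") linarith+
next
  case (R c)
  then have "trk (t + p) = R c" using assms(1) by simp
  then have "p < 2 * W \<Longrightarrow> p = W" using R_recurs[OF R _ assms(2)] by blast
  then show ?thesis using sizes(1) by (cases "p < 2 * W") linarith+
qed

lemma grp_kick:
  assumes "g < K"
  shows "grp (L (2 * (K - 1 - g))) = Some g" "grp (L (2 * (K - 1 - g) + 1)) = Some g"
    "grp (R (2 * g + 1)) = Some g" "grp (R (2 * g + 2)) = Some g"
  using assms by auto

definition kick where
  "kick g \<tau> \<longleftrightarrow> g < K \<and> (\<exists>i\<in>E g. \<tau> = T g + i * P)"

lemma kickD:
  assumes "kick g \<tau>"
  shows "g < K" "off \<tau> = 4 * g + 2"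
    "trk \<tau> = L (2 * (K - 1 - g))" "trk (\<tau> + 1) = R (2 * g + 1)"
    "trk (\<tau> + 2) = L (2 * (K - 1 - g) + 1)" "trk (\<tau> + 3) = R (2 * g + 2)"
    "off (\<tau> + 2) = 4 * g + 4" "off (\<tau> + 4) = 4 * g + 6" "4 * g + 6 < 2 * B"
proof -
  obtain i where i: "g < K" "\<tau> = T g + i * P" using assms by (auto simp: kick_def)
  note k = kick_trk[OF i]
  show "g < K" "off \<tau> = 4 * g + 2"
    "trk \<tau> = L (2 * (K - 1 - g))" "trk (\<tau> + 1) = R (2 * g + 1)"
    "trk (\<tau> + 2) = L (2 * (K - 1 - g) + 1)" "trk (\<tau> + 3) = R (2 * g + 2)"
    by (fact i k)+
  show g: "4 * g + 6 < 2 * B" using i(1) sizes(7) by linarith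
  then have "off \<tau> + 2 < W" "off \<tau> + 4 < W" using k(1) sizes(1,2,6) by linarith+
  then show "off (\<tau> + 2) = 4 * g + 4" "off (\<tau> + 4) = 4 * g + 6"
    using add_same_row(1)[of \<tau> 2] add_same_row(1)[of \<tau> 4] k(1) by simp_all
qed

lemma stay_no_kick:
  assumes "stay s t" "kick g \<tau>" "grp (trk t) = Some g"
  shows "\<not> (s < \<tau> \<and> \<tau> \<le> t)"
  using assms unfolding stay_def kick_def by auto

lemma stay_exact:
  assumes "stay t (t + p)" "0 < p" "p \<le> 2 * n - 3"
  obtains u where "trk t = L u" "p = n - 1" "2 \<le> off t"
  | u where "trk t = L u" "p = 2 * A" "off t = 0"
  | c where "trk t = R c" "p = n + 1"
proof (cases "trk t")
  case (L u)
  then have "trk (t + p) = L u" using assms(1) by (simp add: stay_def)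
  from L_recurs[OF L this assms(2,3)] show ?thesis using that(1,2)[OF L] by blast
next
  case (R c)
  then have "trk (t + p) = R c" using assms(1) by (simp add: stay_def)
  moreover have "p < 2 * W" using assms(3) sizes(1) by linarith
  ultimately have "p = n + 1" using R_recurs[OF R _ assms(2)] sizes(1) by simp
  then show ?thesis using that(3)[OF R] by blast
qed

text \<open>The bound on \<open>p\<close> leaves no room for a second return, so \<open>t\<close> is
  the last reading of the old track before those at the kick, and \<open>t + p\<close> the reading
  of the new track at the kick. The tracks of phases 0, 3, 1, 2 are read at \<open>\<tau>\<close> to
  \<open>\<tau> + 3\<close>; the return times \<open>n - 1\<close> on \<open>L\<close> and
  \<open>n + 1\<close> on \<open>R\<close> give the numbers.\<close>

lemma move_exact:
  assumes "move t (t + p)" "p \<le> 2 * n - 3"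
  obtains (LL) g \<tau> where "kick g \<tau>" "\<tau> = t + (n - 1)" "p = n + 1" "trk t = L (2 * (K - 1 - g))"
  | (LR) g \<tau> where "kick g \<tau>" "\<tau> = t + (n - 3)" "p = n" "trk t = L (2 * (K - 1 - g) + 1)"
  | (RR) g \<tau> where "kick g \<tau>" "\<tau> = t + (n - 2)" "p = n - 1" "trk t = R (2 * g + 2)"
  | (RL) g \<tau> where "kick g \<tau>" "\<tau> = t + n" "p = n" "trk t = R (2 * g + 1)"
proof -
  obtain g i where gi: "g < K" "i \<in> E g" "t < T g + i * P" "T g + i * P \<le> t + p"
    and cases: "trk t = L (2 * (K - 1 - g)) \<and> trk (t + p) = L (2 * (K - 1 - g) + 1) \<or>
      trk t = L (2 * (K - 1 - g) + 1) \<and> trk (t + p) = R (2 * g + 2) \<or>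
      trk t = R (2 * g + 2) \<and> trk (t + p) = R (2 * g + 1) \<or>
      trk t = R (2 * g + 1) \<and> trk (t + p) = L (2 * (K - 1 - g))"
    using assms(1) unfolding move_def by blast
  define \<tau> where "\<tau> = T g + i * P"
  have k: "kick g \<tau>" using gi by (auto simp: kick_def \<tau>_def)
  have \<tau>: "t < \<tau>" "\<tau> \<le> t + p" using gi by (simp_all add: \<tau>_def)
  note kd = kickD[OF k]
  have backL: "\<tau> + e = t + (n - 1)"
    if "trk t = L u" "trk (\<tau> + e) = L u" "\<tau> + e \<le> t + (2 * n - 3)" "off (\<tau> + e) < 2 * A" for u e
  proof -
    have e: "t + (\<tau> + e - t) = \<tau> + e" using \<tau> by simp
    have "\<tau> + e - t = n - 1 \<and> 2 \<le> off t \<or> \<tau> + e - t = 2 * A \<and> off t = 0"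
    proof (rule L_recurs[OF that(1)])
      show "trk (t + (\<tau> + e - t)) = L u" unfolding e by (fact that(2))
    qed (use that(3) \<tau> in auto)
    \<comment> \<open>The exceptional return time \<open>2 * A\<close> ends in column
      \<open>2 * A\<close>, to the right of the column of \<open>\<tau> + e\<close>.\<close>
    moreover have "\<not> (\<tau> + e - t = 2 * A \<and> off t = 0)"
    proof
      assume a: "\<tau> + e - t = 2 * A \<and> off t = 0"
      then have "off t + 2 * A < W" using WA by linarith
      from add_same_row(1)[OF this] have "off (t + 2 * A) = 2 * A" using a by simp
      moreover have "t + 2 * A = \<tau> + e" using a e by simp
      ultimately show False using that(4) by (simp only:)
    qed
    ultimately show ?thesis using \<tau> by linarith
  qed
  have backR: "\<tau> + e = t + W" if "trk t = R c" "trk (\<tau> + e) = R c" "\<tau> + e < t + 2 * W" for c e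
  proof -
    have e: "t + (\<tau> + e - t) = \<tau> + e" using \<tau> by simp
    have "\<tau> + e - t = W"
    proof (rule R_recurs[OF that(1)])
      show "trk (t + (\<tau> + e - t)) = R c" unfolding e by (fact that(2))
    qed (use that(3) \<tau> in auto)
    then show ?thesis using \<tau> by linarith
  qed
  have forth: "t + p = \<tau> + e \<or> \<tau> + e + (n - 1) \<le> t + p"
    if "trk (t + p) = trk (\<tau> + e)" "\<tau> + e \<le> t + p" for e
  proof (cases "t + p = \<tau> + e")
    case False
    then have e: "\<tau> + e + (t + p - (\<tau> + e)) = t + p" using that(2) by simp
    then have "trk (\<tau> + e) = trk (\<tau> + e + (t + p - (\<tau> + e)))" using that(1) by simp
    then have "n - 1 \<le> t + p - (\<tau> + e)" by (rule trk_recurs) (use False that(2) in simp)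
    then show ?thesis using e by linarith
  qed simp
  have after: "\<tau> + e \<le> t + p"
    if "\<And>d. d < e \<Longrightarrow> trk (\<tau> + d) \<noteq> trk (t + p)" for e
  proof (rule ccontr)
    assume "\<not> \<tau> + e \<le> t + p"
    then have "t + p - \<tau> < e" "\<tau> + (t + p - \<tau>) = t + p" using \<tau> by auto
    then show False using that by metis
  qed
  have less2: "d = 0 \<or> d = 1" if "d < 2" for d :: nat using that by auto
  have less3: "d = 0 \<or> d = 1 \<or> d = 2" if "d < 3" for d :: nat using that by auto
  have o0: "off (\<tau> + 0) < 2 * A" and o2: "off (\<tau> + 2) < 2 * A"
    using kd(2,7,9) sizes(6) by simp_all
  have t0: "trk (\<tau> + 0) = L (2 * (K - 1 - g))" using kd by simp
  from cases show ?thesis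
  proof (elim disjE conjE)
    assume a: "trk t = L (2 * (K - 1 - g))" "trk (t + p) = L (2 * (K - 1 - g) + 1)"
    have b: "\<tau> = t + (n - 1)" using backL[OF a(1) t0] o0 \<tau> assms(2) by simp
    have "\<tau> + 2 \<le> t + p" by (rule after) (use less2 kd a in fastforce)
    then have "t + p = \<tau> + 2" using forth[of 2] a kd b assms(2) n27 by auto
    then have "p = n + 1" using b n27 by simp
    then show ?thesis using LL k b a by blast
  next
    assume a: "trk t = L (2 * (K - 1 - g) + 1)" "trk (t + p) = R (2 * g + 2)"
    have f: "\<tau> + 3 \<le> t + p" by (rule after) (use less3 kd a in fastforce)
    have b: "\<tau> + 2 = t + (n - 1)" using backL[OF a(1) kd(5)] o2 f assms(2) by simp
    have "t + p = \<tau> + 3" using forth[of 3] a kd b f assms(2) n27 by auto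
    then have "p = n" "\<tau> = t + (n - 3)" using b n27 by simp_all
    then show ?thesis using LR k a by blast
  next
    assume a: "trk t = R (2 * g + 2)" "trk (t + p) = R (2 * g + 1)"
    have b: "\<tau> + 3 = t + W" using backR[OF a(1) kd(6)] \<tau> assms(2) sizes(1) n27 by simp
    have "\<tau> + 1 \<le> t + p" by (rule after) (use kd a in simp)
    then have "t + p = \<tau> + 1" using forth[of 1] a kd b assms(2) sizes(1) n27 by auto
    then have "p = n - 1" "\<tau> = t + (n - 2)" using b sizes(1) n27 by simp_all
    then show ?thesis using RR k a by blast
  next
    assume a: "trk t = R (2 * g + 1)" "trk (t + p) = L (2 * (K - 1 - g))"
    have b: "\<tau> + 1 = t + W" using backR[OF a(1) kd(4)] \<tau> assms(2) sizes(1) n27 by simp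
    have "t + p = \<tau>" using forth[of 0] a kd b \<tau> assms(2) sizes(1) n27 by auto
    then have "p = n" "\<tau> = t + n" using b sizes(1) n27 by simp_all
    then show ?thesis using RL k a by blast
  qed
qed

lemma P_large: "2 * n < P"
proof -
  have "W * 13 \<le> P" unfolding P_def using sizes(4) by (intro mult_le_mono2)
  then show ?thesis using sizes(1) by linarith
qed

lemma no_short_recurrence:
  assumes "x t = x (t + p)" "0 < p"
  shows "n - 1 \<le> p"
proof (rule ccontr)
  assume "\<not> n - 1 \<le> p"
  then have p: "p \<le> 2 * n - 3" "p < n - 1" "p < P" using n27 P_large by linarith+
  from x_eq_short[OF assms(1) p(3)] show False
  proof
    assume "stay t (t + p)"
    then have "trk t = trk (t + p)" by (simp add: stay_def)
    from trk_recurs[OF this assms(2)] show False using p(2) by linarith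
  next
    assume "move t (t + p)"
    then show False by (rule move_exact[OF _ p(1)]) (use p(2) in linarith)+
  qed
qed

text \<open>A kick begins on an \<open>L\<close>-position, in a column congruent to 2 modulo 4. At
  distance 4 the second one would belong to group \<open>g + 1\<close>, but the
  \<open>L\<close>-stream runs through the groups in the opposite order.\<close>

lemma kicks_apart:
  assumes "kick g \<tau>" "kick h \<sigma>"
  shows "\<sigma> \<noteq> \<tau> + 1" "\<sigma> \<noteq> \<tau> + 2" "\<sigma> \<noteq> \<tau> + 4"
proof -
  note k = kickD[OF assms(1)] and l = kickD[OF assms(2)]
  show "\<sigma> \<noteq> \<tau> + 1" using k(4) l(3) by auto
  show "\<sigma> \<noteq> \<tau> + 2"
  proof
    assume "\<sigma> = \<tau> + 2"
    then have "4 * h + 2 = 4 * g + 4" using k(7) l(2) by simp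
    then have "2 * h = 2 * g + 1" by simp
    then show False by presburger
  qed
  show "\<sigma> \<noteq> \<tau> + 4"
  proof
    assume s: "\<sigma> = \<tau> + 4"
    then have h: "h = g + 1" using k(8) l(2) by simp
    have e: "\<tau> + 2 + 2 = \<sigma>" using s by simp
    have v: "Suc (2 * (K - 1 - g) + 1) mod A = 2 * (K - 1 - g) + 2"
      using k(1) sizes(6,7,9) by simp
    show False
    proof (cases "\<tau> + 2" rule: two_later_cases)
      case (LL u)
      then have "2 * (K - 1 - g) + 2 = 2 * (K - 1 - h)" using k(5) l(3) v unfolding e by simp
      then show False using h by simp
    next
      case first
      then show False using l(3) unfolding e by simp
    qed (use k(5) in simp_all)
  qed
qed

lemma adjacent_types:
  "off (Suc t) = Suc (off t) \<or> off (Suc t) = 0 \<and> off t = n"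
proof (cases "off t + 1 < W")
  case True
  then show ?thesis using add_same_row(1)[OF True] by simp
next
  case False
  then have "off t = n" using off_less[of t] sizes(1) by linarith
  then show ?thesis using add_next_row(1)[of t 1] sizes(1) by simp
qed

lemma stay_parity:
  assumes "stay t (t + p)" "0 < p" "p \<le> 2 * n - 3"
  shows "even (off t) \<and> (p = n - 1 \<and> 2 \<le> off t \<or> p = 2 * A \<and> off t = 0) \<or> odd (off t) \<and> p = n + 1"
  using assms by (rule stay_exact) (simp_all add: trk_L trk_R)

lemma move_kick:
  assumes "move t (t + p)" "p \<le> 2 * n - 3"
  shows "p = n + 1 \<and> (\<exists>g. kick g (t + (n - 1))) \<or> p = n - 1 \<and> (\<exists>g. kick g (t + (n - 2)))
    \<or> p = n \<and> ((\<exists>g. kick g (t + (n - 3))) \<or> (\<exists>g. kick g (t + n)))"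
  using assms by (rule move_exact) blast+

text \<open>Two adjacent stays need different periods. A move beside a stay would put a kick of the
  staying letter's group in between, unless \<open>p = n\<close>, where a stay needs column 0. Two
  adjacent moves would need kicks at distance 1, 2 or 4.\<close>

lemma no_short_pair:
  assumes "x t = x (t + p)" "x (t + 1) = x (t + 1 + p)" "0 < p" "p \<le> 2 * n - 3"
  shows False
proof -
  have pP: "p < P" using assms(4) P_large by linarith
  have adj: "off (t + 1) = off t + 1 \<or> off (t + 1) = 0 \<and> off t = n"
    using adjacent_types[of t] by simp
  note sa = stay_parity[OF _ assms(3,4), of t] and sb = stay_parity[OF _ assms(3,4), of "t + 1"]
  note ma = move_exact[OF _ assms(4), of t] and mb = move_exact[OF _ assms(4), of "t + 1"]
  consider "stay t (t + p)" "stay (t + 1) (t + 1 + p)" | "stay t (t + p)" "move (t + 1) (t + 1 + p)"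
    | "move t (t + p)" "stay (t + 1) (t + 1 + p)" | "move t (t + p)" "move (t + 1) (t + 1 + p)"
    using x_eq_short[OF assms(1) pP] x_eq_short[OF assms(2) pP] by blast
  then show False
  proof cases
    case 1
    note ab = sa[OF 1(1)] sb[OF 1(2)]
    from adj show False
    proof
      assume "off (t + 1) = off t + 1"
      then have "even (off t) \<longleftrightarrow> odd (off (t + 1))" by simp
      then have "p = n + 1" "p = n - 1 \<or> p = 2 * A" using ab by blast+
      then show False using sizes(3) by linarith
    next
      assume o: "off (t + 1) = 0 \<and> off t = n"
      then have "p = 2 * A" using ab(2) by simp
      moreover have "even n \<and> p = n - 1 \<or> p = n + 1" using ab(1) o n27 by auto
      ultimately show False using sizes(3) even_sizes(1) n27 by (elim disjE conjE) linarith+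
    qed
  next
    case 2
    show False
    proof (rule mb[OF 2(2)])
      fix g \<tau> assume k: "kick g \<tau>" "\<tau> = t + 1 + (n - 1)" "p = n + 1"
      then have e: "t + p = \<tau> + 1" using n27 by simp
      have "grp (trk (t + p)) = Some g"
        unfolding e kickD(4)[OF k(1)] by (rule grp_kick(3)[OF kickD(1)[OF k(1)]])
      then show False using stay_no_kick[OF 2(1) k(1)] k(2) e by simp
    next
      fix g \<tau> assume k: "kick g \<tau>" "p = n" "trk (t + 1) = L (2 * (K - 1 - g) + 1)"
      have "off t = 0" using sa[OF 2(1)] k(2) n27 by auto
      then have "off (t + 1) = 1" using adj n27 by simp
      then show False using k(3) by (simp add: trk_L)
    next
      fix g \<tau> assume k: "kick g \<tau>" "\<tau> = t + 1 + (n - 2)" "p = n - 1"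
      then have e: "t + p = \<tau>" using n27 by simp
      have "grp (trk (t + p)) = Some g"
        unfolding e kickD(3)[OF k(1)] by (rule grp_kick(1)[OF kickD(1)[OF k(1)]])
      then show False using stay_no_kick[OF 2(1) k(1)] k(2) e by simp
    next
      fix g \<tau> assume k: "kick g \<tau>" "p = n" "trk (t + 1) = R (2 * g + 1)"
      have "off t = 0" using sa[OF 2(1)] k(2) n27 by auto
      then have "off (t + 1) = 1" using adj n27 by simp
      then show False using trk_R_less[OF k(3)] by simp
    qed
  next
    case 3
    show False
    proof (rule ma[OF 3(1)])
      fix g \<tau> assume k: "kick g \<tau>" "\<tau> = t + (n - 1)" "p = n + 1"
      then have e: "t + 1 + p = \<tau> + 3" using n27 by simp
      have "grp (trk (t + 1 + p)) = Some g"
        unfolding e kickD(6)[OF k(1)] by (rule grp_kick(4)[OF kickD(1)[OF k(1)]])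
      moreover have "t + 1 < \<tau>" "\<tau> \<le> t + 1 + p" using e k(2) n27 by linarith+
      ultimately show False using stay_no_kick[OF 3(2) k(1)] by blast
    next
      fix g \<tau> assume k: "kick g \<tau>" "\<tau> = t + (n - 3)" "p = n"
      have "off (t + 1) = 0 \<and> p = 2 * A" using sb[OF 3(2)] k(3) n27 by auto
      then have o: "off t = n" "n = 2 * A" using adj k(3) by auto
      \<comment> \<open>So \<open>\<tau> + 4\<close> would lie in the last column, like
        \<open>t\<close>, but kicks lie further left.\<close>
      have "t + W = \<tau> + 4" using k(2) sizes(1) n27 by simp
      then have "off (\<tau> + 4) = off t" using dvd_W_iff[of W t] by simp
      moreover have "B = A" using o(2) sizes(2) by linarith
      ultimately show False using kickD(8,9)[OF k(1)] o by linarith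
    next
      fix g \<tau> assume k: "kick g \<tau>" "\<tau> = t + (n - 2)" "p = n - 1"
      then have e: "t + 1 + p = \<tau> + 2" using n27 by simp
      have "grp (trk (t + 1 + p)) = Some g"
        unfolding e kickD(5)[OF k(1)] by (rule grp_kick(2)[OF kickD(1)[OF k(1)]])
      moreover have "t + 1 < \<tau>" "\<tau> \<le> t + 1 + p" using e k(2) n27 by linarith+
      ultimately show False using stay_no_kick[OF 3(2) k(1)] by blast
    next
      fix g \<tau> assume k: "kick g \<tau>" "p = n" "trk t = R (2 * g + 1)"
      have "off (t + 1) = 0 \<and> p = 2 * A" using sb[OF 3(2)] k(2) n27 by auto
      then have "off t = 2 * A" using adj k(2) by auto
      then show False using k(3) by (simp add: trk_R)
    qed
  next
    case 4
    have apart: False if "kick g \<tau>" "kick h \<sigma>" "\<sigma> = \<tau> + 1 \<or> \<tau> = \<sigma> + 2 \<or> \<sigma> = \<tau> + 4" for g h \<tau> \<sigma>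
      using kicks_apart that by blast
    have e: "t + 1 + (n - 1) = t + (n - 1) + 1" "t + 1 + (n - 2) = t + (n - 2) + 1"
      "t + 1 + (n - 3) = t + (n - 3) + 1" "t + 1 + n = t + n + 1" "t + 1 + n = t + (n - 3) + 4"
      "t + n = t + 1 + (n - 3) + 2"
      using n27 by simp_all
    \<comment> \<open>The period determines the kind of move, except that \<open>p = n\<close> has
      two kinds.\<close>
    have "n + 1 \<noteq> n - 1" "n + 1 \<noteq> n" "n - 1 \<noteq> n" using n27 by simp_all
    then consider g h where "kick g (t + (n - 1))" "kick h (t + 1 + (n - 1))"
      | g h where "kick g (t + (n - 2))" "kick h (t + 1 + (n - 2))"
      | g h where "kick g (t + (n - 3))" "kick h (t + 1 + (n - 3))"
      | g h where "kick g (t + (n - 3))" "kick h (t + 1 + n)"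
      | g h where "kick g (t + n)" "kick h (t + 1 + (n - 3))"
      | g h where "kick g (t + n)" "kick h (t + 1 + n)"
      using move_kick[OF 4(1) assms(4)] move_kick[OF 4(2) assms(4)] by metis
    then show False
      by cases (erule (1) apart, use e in blast)+
  qed
qed

lemma match_multiple_of_P:
  assumes "0 < p" "p < k * (n - 1)" "\<And>i. i < k \<Longrightarrow> x (t + i) = x (t + i + p)"
  shows "P dvd p"
proof -
  have k: "m < k" if "m * (n - 1) \<le> p" for m
  proof (rule ccontr)
    assume "\<not> m < k"
    then have "k * (n - 1) \<le> m * (n - 1)" by (intro mult_le_mono1) simp
    then have "k * (n - 1) \<le> p" using that by (rule order_trans)
    then show False using leD assms(2) by blast
  qed
  have P: "13 * (n + 1) \<le> P" unfolding P_def sizes(1)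
    using sizes(4) by (metis mult.commute mult_le_mono2)
  \<comment> \<open>These ranges guarantee at least 1, 2, 3, 4 and 12 matches, respectively.\<close>
  consider "p < n - 1" | "n - 1 \<le> p" "p \<le> 2 * n - 3"
    | "2 * n - 2 \<le> p" "p \<le> 3 * n - 4" "p < P" | "3 * (n - 1) \<le> p" "p < P" | "P \<le> p"
    using n27 by linarith
  then show ?thesis
  proof cases
    case 1
    then show ?thesis using no_short_recurrence[of t p] assms(1) assms(3)[of 0] k[of 0] by simp
  next
    case 2
    then have "1 < k" using k[of 1] by simp
    then show ?thesis using no_short_pair[of t p] assms(1) assms(3)[of 0] assms(3)[of 1] 2 by simp
  next
    case 3
    then have "2 < k" using k[of 2] n27 by simp
    then have "step (trk (t + i)) (trk (t + i + p))" if "i < 3" for i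
      using x_eq_step[OF assms(3)] 3 that by simp
    then show ?thesis using not_step_LRL[OF 3] by blast
  next
    case 4
    then have k3: "3 < k" using k[of 3] by simp
    have s: "step (trk (t + i)) (trk (t + i + p))" if "i < 4" for i
      using x_eq_step[OF assms(3)] 4 that k3 by simp
    have p: "2 * n - 2 \<le> p" using 4 n27 by linarith
    have w: "even (off t)" "off t + 3 < W"
      using step_window[OF p 4(2), of t] s by simp_all
    \<comment> \<open>Both windows of three matches would have to begin in an even column.\<close>
    have "step (trk (t + 1 + i)) (trk (t + 1 + i + p))" if "i < 3" for i
      using s[of "Suc i"] that by simp
    then have "even (off (t + 1))" using step_window[OF p 4(2), of "t + 1"] by blast
    moreover have "off (t + 1) = off t + 1" using add_same_row(1)[of t 1] w by simp
    ultimately show ?thesis using w by simp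
  next
    case 5
    moreover have "11 * (n - 1) \<le> 13 * (n + 1)" by (intro mult_le_mono) simp_all
    ultimately have "11 * (n - 1) \<le> p" using P by (meson order_trans)
    then have k12: "12 \<le> k" using k[of 11] by simp
    \<comment> \<open>At most 7 steps lead to an odd column with four more columns to its right; 5
      of the 12 matches remain.\<close>
    obtain s where s: "s \<le> 7" "odd (off (t + s))" "off (t + s) + 4 < W"
    proof (cases "off t + 5 < W")
      case True
      then show ?thesis
        using that[of 0] that[of 1] add_same_row(1)[of t 1] by (cases "even (off t)") auto
    next
      case False
      define s where "s = W - off t + 1"
      have "s \<le> 7" "s \<le> W" "off t + s - W = 1" "W \<le> off t + s"
        using False off_less[of t] sizes(1) n27 unfolding s_def by linarith+
      moreover from this have "off (t + s) = 1" using add_next_row(1)[of t s] by simp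
      ultimately show ?thesis using that[of s] sizes(1) n27 by simp
    qed
    have "x (t + s + i) = x (t + s + i + p)" if "i < 5" for i
      using assms(3)[of "s + i"] that s(1) k12 by (simp add: add.assoc)
    then show ?thesis using period_dvd[OF s(2,3)] by blast
  qed
qed

section \<open>Multiples of \<open>P\<close>\<close>

lemma trit1_power3:
  assumes "j mod 3 \<noteq> 0"
  shows "trit1 (3 ^ e * j) \<longleftrightarrow> j mod 3 = 1"
proof
  assume "trit1 (3 ^ e * j)"
  then obtain e' j' where "3 ^ e * j = 3 ^ e' * j'" "j' mod 3 = 1" by (auto simp: trit1_def)
  then show "j mod 3 = 1" using power3_mult_inject[of e j e' j'] assms by simp
qed (auto simp: trit1_def)

lemma trk_add_P: "trk (t + q * P) = trk t"
proof -
  have W: "W dvd q * P" by (simp add: P_def)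
  have "q * P = q * A * W" by (simp add: P_def)
  moreover have "0 < W" using sizes(1) by simp
  ultimately have d: "q * P div W = q * A" by (metis div_mult_self_is_m)
  have "off (t + q * P) = off t" using W dvd_W_iff by blast
  then show ?thesis
    using row_add_W[OF W, of t] unfolding d trk_def
    by (metis add.assoc add.commute mod_mult_self1)
qed

text \<open>\<open>i\<close> is the index of the first kick time after \<open>t\<close>, and
  \<open>q * P\<close> further steps raise it by \<open>q\<close>.\<close>

lemma kicks_period:
  assumes "g < K" "i = (t + P - T g) div P"
  shows "kicks g t (t + q * P) = E g \<inter> {i..<i + q}"
proof -
  have T: "T g < P" using T_less assms(1) by blast
  have le: "T g + j * P \<le> s \<longleftrightarrow> j < (s + P - T g) div P" for s j
  proof -
    have "j < (s + P - T g) div P \<longleftrightarrow> Suc j * P \<le> s + P - T g"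
      using sizes(10) by (simp add: less_eq_div_iff_mult_less_eq Suc_le_eq[symmetric])
    also have "\<dots> \<longleftrightarrow> T g + j * P \<le> s" using T by auto
    finally show ?thesis by blast
  qed
  have "t + q * P + P - T g = t + P - T g + q * P" using T by simp
  then have "(t + q * P + P - T g) div P = i + q" using assms(2) sizes(10) by simp
  then have "T g + j * P \<le> t + q * P \<longleftrightarrow> j < i + q" for j using le by simp
  moreover have "t < T g + j * P \<longleftrightarrow> i \<le> j" for j
    using le[of j t] assms(2) by (simp add: not_le[symmetric])
  ultimately show ?thesis by (auto simp: kicks_def)
qed

text \<open>The track, and so the phase, is the same after \<open>q * P\<close> steps, hence the
  kicks in between cancel modulo 4.\<close>

lemma card_kicks_period:
  assumes "x s = x (s + q * P)" "grp (trk s) = Some g" "i = (s + P - T g) div P"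
  shows "card (E g \<inter> {i..<i + q}) mod 4 = 0"
proof -
  have "phase (trk s) mod 4 = (phase (trk s) + card (kicks g s (s + q * P))) mod 4"
    using x_eq_phase[OF assms(1,2)] by (simp only: trk_add_P)
  then have "4 dvd card (kicks g s (s + q * P))" by (metis mod_add_self_iff)
  then show ?thesis using kicks_period[OF grp_less[OF assms(2)] assms(3)] by simp
qed

lemma off_in_interval:
  assumes "d < W"
  obtains s where "t \<le> s" "s < t + W" "off s = d"
  using residue_in_interval[OF assms, of t] unfolding off_def by blast

lemma off_group:
  assumes "g < K"
  shows "off s = 4 * g + 3 \<Longrightarrow> grp (trk s) = Some g" "off s = 4 * g + 5 \<Longrightarrow> grp (trk s) = Some g"
proof -
  show "grp (trk s) = Some g" if "off s = 4 * g + 3"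
  proof -
    have "trk s = R (2 * g + 1)" using that by (simp add: trk_R)
    then show ?thesis using grp_kick(3)[OF assms] by simp
  qed
  show "grp (trk s) = Some g" if "off s = 4 * g + 5"
  proof -
    have "trk s = R (2 * g + 2)" using that by (simp add: trk_R)
    then show ?thesis using grp_kick(4)[OF assms] by simp
  qed
qed

lemma g2_bounds: "4 * g2 \<le> A + 4" "A + 1 \<le> 4 * g2" "4 \<le> g2" "g2 < K"
proof -
  show a: "4 * g2 \<le> A + 4" "A + 1 \<le> 4 * g2" unfolding g2_def by auto
  then show "4 \<le> g2" using sizes(4) by linarith
  show "g2 < K" using a sizes(3,4,2,8) n27 by linarith
qed

text \<open>The \<open>R\<close>-tracks of groups 0 and \<open>g2\<close> have columns 3, 5,
  \<open>4 * g2 + 3\<close> and \<open>4 * g2 + 5\<close>, with cyclic gaps of at most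
  \<open>A + 2\<close>.\<close>

lemma always_kicked_near:
  obtains s g where "t \<le> s" "s \<le> t + A + 1" "grp (trk s) = Some g" "E g = UNIV"
proof -
  have near: thesis if "t \<le> s" "s \<le> t + A + 1" "off s \<in> {3, 5, 4 * g2 + 3, 4 * g2 + 5}" for s
  proof -
    have "off s = 4 * 0 + 3 \<or> off s = 4 * 0 + 5 \<or> off s = 4 * g2 + 3 \<or> off s = 4 * g2 + 5"
      using that(3) by auto
    then have "grp (trk s) = Some 0 \<or> grp (trk s) = Some g2"
      using off_group[of 0 s] off_group[of g2 s] g2_bounds(4) by auto
    then show thesis using \<open>\<And>s g. \<lbrakk>t \<le> s; s \<le> t + A + 1; grp (trk s) = Some g; E g = UNIV\<rbrakk> \<Longrightarrow> thesis\<close>[OF that(1,2)] by (auto simp: E_def)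
  qed
  have fwd: thesis if "off t \<le> d" "d \<le> off t + A + 1" "d \<in> {3, 5, 4 * g2 + 3, 4 * g2 + 5}" for d
  proof -
    have "d < W" using that(3) g2_bounds(1) sizes(1,3,4) n27 by auto
    then have "off (t + (d - off t)) = d" using add_same_row(1)[of t "d - off t"] that(1) by simp
    then show thesis using near[of "t + (d - off t)"] that by simp
  qed
  consider "off t \<le> 3" | "3 < off t" "off t \<le> 5" | "5 < off t" "off t \<le> 4 * g2 + 3"
    | "4 * g2 + 3 < off t" "off t \<le> 4 * g2 + 5" | "4 * g2 + 5 < off t" by linarith
  then show thesis
  proof cases
    case 5
    define s where "s = W - off t + 3"
    have "W \<le> off t + s" "s \<le> W" "off t + s - W = 3" "s \<le> A + 1"
      using 5 off_less[of t] g2_bounds(2) sizes(1,3) unfolding s_def by linarith+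
    moreover from this have "off (t + s) = 3" using add_next_row(1)[of t s] by simp
    ultimately show thesis using near[of "t + s"] by simp
  qed (use fwd[of 3] fwd[of 5] fwd[of "4 * g2 + 3"] fwd[of "4 * g2 + 5"] g2_bounds(1) sizes(4) in auto)
qed

text \<open>A group kicked in every period gets \<open>q\<close> kicks, so 4 divides
  \<open>q\<close>. Once \<open>4 ^ Suc l\<close> divides \<open>q\<close>, the group kicked in
  every such period gets exactly the quotient as its number of kicks, which is again divisible by
  4.\<close>

lemma four_power_dvd:
  assumes q: "0 < q" and m: "\<And>i. i \<le> q * (A + 1) \<Longrightarrow> x (t + i) = x (t + i + q * P)"
  shows "4 ^ (K - 2) dvd q"
proof -
  have m': "x s = x (s + q * P)" if "t \<le> s" "s \<le> t + q * (A + 1)" for s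
    using m[of "s - t"] that by simp
  have "4 dvd q"
  proof (rule always_kicked_near[of t])
    fix s g assume s: "t \<le> s" "s \<le> t + A + 1" "grp (trk s) = Some g" "E g = UNIV"
    have "1 * (A + 1) \<le> q * (A + 1)" using q by (intro mult_le_mono1) simp
    then have "x s = x (s + q * P)" using m' s(1,2) by simp
    then show "4 dvd q" using card_kicks_period[OF _ s(3) refl] s(4) by (simp add: dvd_eq_mod_eq_0)
  qed
  then have "4 \<le> q" using q by (auto dest: dvd_imp_le)
  then have "4 * (A + 1) \<le> q * (A + 1)" by (intro mult_le_mono1)
  moreover have "W \<le> 4 * (A + 1)" using WA by (elim disjE) simp_all
  \<comment> \<open>The match now covers a whole row, so every group occurs in it.\<close>
  ultimately have long: "W \<le> q * (A + 1)" by (rule order_trans[rotated])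
  have "4 ^ Suc l dvd q" if "Suc l \<le> K - 2" for l
    using that
  proof (induction l)
    case 0
    show ?case using \<open>4 dvd q\<close> by simp
  next
    case (Suc l)
    \<comment> \<open>The group kicked in every \<open>4 ^ Suc l\<close>-th period; the numbering
      skips 0, 1 and \<open>g2\<close>.\<close>
    define g where "g = (if l + 2 < g2 then l + 2 else l + 3)"
    have g: "g < K" using Suc.prems by (auto simp: g_def)
    have Eg: "E g = {i. 4 ^ Suc l dvd i}"
      using g2_bounds(3) by (auto simp: E_def g_def)
    have "4 * g + 3 < W" using g sizes(1,2,6,7) by linarith
    then obtain s where s: "t \<le> s" "s < t + W" "off s = 4 * g + 3" using off_in_interval by blast
    have dvd: "4 ^ Suc l dvd q" using Suc by simp
    then obtain z where z: "q = 4 ^ Suc l * z" by blast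
    have "x s = x (s + q * P)" using m' s(1,2) long by simp
    then have "card (E g \<inter> {(s + P - T g) div P..<(s + P - T g) div P + q}) mod 4 = 0"
      by (rule card_kicks_period[OF _ off_group(1)[OF g s(3)] refl])
    then have "4 dvd z" unfolding Eg z by (subst (asm) card_multiples) (auto simp: dvd_eq_mod_eq_0)
    then show ?case unfolding z by (auto elim!: dvdE)
  qed
  from this[of "K - 3"] show ?thesis using sizes(9) by (simp add: Suc_diff_Suc numeral_eq_Suc)
qed

lemma four_power_large: "5 * n + 3 \<le> 4 ^ (K - 2)"
proof -
  \<comment> \<open>As \<open>n \<le> 4 * K + 6\<close>, the left side of the claim is at most
    \<open>20 * (K - 6) + 153\<close>; \<open>6 \<le> K\<close> comes from
    \<open>27 \<le> n\<close>.\<close>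
  have "153 + 20 * m \<le> 256 * 4 ^ m" for m :: nat
    by (induction m) auto
  from this[of "K - 6"] have "153 + 20 * (K - 6) \<le> 4 ^ 4 * 4 ^ (K - 6)" by simp
  also have "\<dots> = 4 ^ (4 + (K - 6))" by (simp only: power_add)
  also have "4 + (K - 6) = K - 2" using sizes(9) by simp
  finally show ?thesis using sizes(2,5,8,9) by linarith
qed

text \<open>The kick time of group 1 in period \<open>i\<close> lies between two readings of one of
  its tracks a row apart. Their matches compare the kicks in \<open>q\<close> periods from
  \<open>i\<close> and from \<open>i + 1\<close>, so \<open>card_Int_shift\<close> applies.\<close>

lemma match_trit1:
  assumes "0 < q" and m: "\<And>s. t \<le> s \<Longrightarrow> s \<le> t + q * (A + 1) \<Longrightarrow> x s = x (s + q * P)"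
    and i: "t + W \<le> T 1 + i * P" "T 1 + i * P < t + q * (A + 1)"
  shows "trit1 i \<longleftrightarrow> trit1 (i + q)"
proof -
  have K: "1 < K" using sizes(9) by simp
  have T: "T 1 < P" using T_less K by blast
  have WP: "W < P" using P_large sizes(1) n27 by simp
  define \<tau> where "\<tau> = T 1 + i * P"
  have "trk (\<tau> + 1) = R (2 * 1 + 1)" using kick_trk(3)[OF K \<tau>_def] .
  then have g1: "grp (trk (\<tau> + 1)) = Some 1" using grp_kick(3)[OF K] by simp
  have W\<tau>: "W \<le> \<tau>" using i(1) by (simp add: \<tau>_def)
  then have "off (\<tau> + 1 - W + W) = off (\<tau> + 1)" by simp
  then have "off (\<tau> + 1 - W) = 7" using kick_trk(1)[OF K \<tau>_def] add_same_row(1)[of \<tau> 1]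
      dvd_W_iff[of W "\<tau> + 1 - W"] sizes(1) n27 by simp
  then have g0: "grp (trk (\<tau> + 1 - W)) = Some 1" using off_group(1)[OF K] by simp
  have quot: "(r + j * P) div P = j" if "r < P" for r j
    using that by simp
  have "\<tau> + 1 + P - T 1 = 1 + Suc i * P" using T by (simp add: \<tau>_def)
  moreover have "1 < P" using WP sizes(1) n27 by linarith
  ultimately have i1: "(\<tau> + 1 + P - T 1) div P = Suc i" using quot by metis
  have "\<tau> + 1 - W + P - T 1 = (P + 1 - W) + i * P" using T W\<tau> WP by (simp add: \<tau>_def)
  moreover have "P + 1 - W < P" using sizes(1,10) n27 by linarith
  ultimately have i0: "(\<tau> + 1 - W + P - T 1) div P = i" using quot by metis
  have in_range: "t \<le> \<tau> + 1 - W" "\<tau> + 1 \<le> t + q * (A + 1)" using i by (simp_all add: \<tau>_def)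
  have "card (E 1 \<inter> {i..<i + q}) mod 4 = 0"
    using card_kicks_period[OF m g0 i0[symmetric]] in_range by simp
  moreover have "card (E 1 \<inter> {Suc i..<Suc i + q}) mod 4 = 0"
    using card_kicks_period[OF m g1 i1[symmetric]] in_range i(1) by (simp add: \<tau>_def)
  ultimately have "i \<in> E 1 \<longleftrightarrow> i + q \<in> E 1" using assms(1) by (rule card_Int_shift)
  moreover have "E 1 = {i. trit1 i}" using g2_bounds(3) by (simp add: E_def)
  ultimately show ?thesis by simp
qed

text \<open>If 3 does not divide \<open>z\<close> in \<open>q = 3 ^ e * z\<close>, some period
  \<open>i\<close> within the match has lowest nonzero ternary digit \<open>z mod 3\<close>, at
  place \<open>e\<close>. Adding \<open>q\<close> doubles this digit modulo 3, which exchanges 1 and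
  2, against \<open>match_trit1\<close>.\<close>

lemma three_power_dvd:
  assumes q: "0 < q" and m: "\<And>i. i \<le> q * (A + 1) \<Longrightarrow> x (t + i) = x (t + i + q * P)"
  shows "3 ^ e dvd q"
proof (induction e)
  case 0
  show ?case by simp
next
  case (Suc e)
  then obtain z where z: "q = 3 ^ e * z" by blast
  show ?case
  proof (rule ccontr)
    assume "\<not> 3 ^ Suc e dvd q"
    then have "\<not> 3 dvd z" unfolding z by simp
    then have z3: "z mod 3 = 1 \<or> z mod 3 = 2" by presburger
    \<comment> \<open>The powers of 4 and 3 together make \<open>q\<close> so large that the match
      covers \<open>3 ^ Suc e\<close> periods and a row.\<close>
    have "coprime (4 :: nat) 3" using coprime_Suc_left_nat[of 3] by simp
    then have "coprime (4 ^ (K - 2) :: nat) (3 ^ e)" by simp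
    then have "4 ^ (K - 2) * 3 ^ e dvd q"
      using four_power_dvd[OF q m] Suc.IH divides_mult by blast
    then have "4 ^ (K - 2) * 3 ^ e \<le> q" using q dvd_imp_le by blast
    then have "(5 * n + 3) * 3 ^ e \<le> q"
      using four_power_large mult_le_mono1 order_trans by blast
    then have "(5 * n + 3) * 3 ^ e * (A + 1) \<le> q * (A + 1)" by (rule mult_le_mono1)
    moreover have "W + 3 ^ Suc e * P < (5 * n + 3) * 3 ^ e * (A + 1)"
    proof -
      define F :: nat where "F = 3 ^ e"
      define X Y Z where "X = F * n * A" and "Y = F * A" and "Z = F * n"
      have F: "0 < F" by (simp add: F_def)
      then have "n \<le> Z" by (simp add: Z_def)
      moreover have "W + 3 ^ Suc e * P = n + 1 + 3 * X + 3 * Y"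
        unfolding P_def sizes(1) power_Suc F_def[symmetric] X_def Y_def by (simp add: algebra_simps)
      moreover have "(5 * n + 3) * 3 ^ e * (A + 1) = 5 * X + 5 * Z + 3 * Y + 3 * F"
        unfolding F_def[symmetric] X_def Y_def Z_def by (simp add: algebra_simps)
      ultimately show ?thesis using F n27 by linarith
    qed
    ultimately have room: "W + 3 ^ Suc e * P < q * (A + 1)" by linarith
    \<comment> \<open>The first period whose kick time of group 1 is at least a row after
      \<open>t\<close>, as \<open>match_trit1\<close> requires.\<close>
    define a where "a = (t + W + P - 1 - T 1) div P"
    have T: "T 1 < P" using T_less sizes(9) by simp
    have a: "t + W \<le> T 1 + a * P" "T 1 + a * P < t + W + P"
    proof -
      define y where "y = t + W + P - 1 - T 1"
      have y: "y + T 1 + 1 = t + W + P" using T by (simp add: y_def)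
      have "y = a * P + y mod P" unfolding a_def y_def[symmetric] by simp
      moreover have "y mod P < P" using sizes(10) by simp
      ultimately show "t + W \<le> T 1 + a * P" "T 1 + a * P < t + W + P" using y by linarith+
    qed
    have "3 ^ e * (z mod 3) < 3 ^ Suc e" by simp
    then obtain i where i: "a \<le> i" "i < a + 3 ^ Suc e" "i mod 3 ^ Suc e = 3 ^ e * (z mod 3)"
      by (rule residue_in_interval)
    have "i = 3 ^ e * (z mod 3) + 3 ^ Suc e * (i div 3 ^ Suc e)"
      unfolding i(3)[symmetric] by (simp only: mod_mult_div_eq)
    then have ie: "i = 3 ^ e * (z mod 3 + 3 * (i div 3 ^ Suc e))" by (simp add: algebra_simps)
    define j where "j = z mod 3 + 3 * (i div 3 ^ Suc e)"
    have j: "j mod 3 = z mod 3" by (simp add: j_def)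
    have iq: "i = 3 ^ e * j" "i + q = 3 ^ e * (j + z)" using ie by (simp_all add: j_def z algebra_simps)
    have jz: "(j + z) mod 3 = (z mod 3 + z mod 3) mod 3" using j by (metis mod_add_eq)
    have "trit1 i \<longleftrightarrow> j mod 3 = 1" unfolding iq(1) using j z3 by (intro trit1_power3) auto
    moreover have "trit1 (i + q) \<longleftrightarrow> (j + z) mod 3 = 1"
      unfolding iq(2) using jz z3 by (intro trit1_power3) auto
    moreover have "trit1 i \<longleftrightarrow> trit1 (i + q)"
    proof (rule match_trit1[OF q])
      show "x s = x (s + q * P)" if "t \<le> s" "s \<le> t + q * (A + 1)" for s
        using m[of "s - t"] that by simp
      have "a * P \<le> i * P" using i(1) by (rule mult_le_mono1)
      then show "t + W \<le> T 1 + i * P" using a by linarith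
      have "Suc i * P \<le> (a + 3 ^ Suc e) * P" using i(2) by (intro mult_le_mono1) simp
      then have "i * P + P \<le> a * P + 3 ^ Suc e * P"
        by (simp only: mult_Suc add_mult_distrib add.commute)
      then show "T 1 + i * P < t + q * (A + 1)" using a room by linarith
    qed
    ultimately show False using j jz z3 by auto
  qed
qed

text \<open>Since \<open>P\<close> is at least \<open>(n - 1) * (A + 1)\<close>, a period
  \<open>q * P\<close> forces more than \<open>q * (A + 1)\<close> matches. Then every power of 3
  divides \<open>q\<close>, even \<open>3 ^ q\<close>, which is larger.\<close>

theorem x_avoids:
  assumes "0 < p" "p < k * (n - 1)" "\<And>i. i < k \<Longrightarrow> x (t + i) = x (t + i + p)"
  shows False
proof -
  obtain q where q: "p = q * P" using match_multiple_of_P[OF assms] by (metis dvd_def mult.commute)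
  then have q0: "0 < q" using assms(1) by (cases q) auto
  have "(n - 1) * (A + 1) \<le> W * A"
  proof -
    obtain m where m: "n - 1 = m" by simp
    then have "W = m + 2" "m \<le> 2 * A" using sizes(1,3) n27 by linarith+
    then show ?thesis unfolding m by (simp add: algebra_simps)
  qed
  then have "q * ((n - 1) * (A + 1)) \<le> q * (W * A)" by (rule mult_le_mono2)
  also have "q * ((n - 1) * (A + 1)) = q * (A + 1) * (n - 1)" by (simp only: ac_simps)
  also have "q * (W * A) < k * (n - 1)" using assms(2) unfolding q P_def .
  finally have "q * (A + 1) * (n - 1) < k * (n - 1)" .
  then have "q * (A + 1) < k" using mult_less_cancel2 by blast
  then have m: "x (t + i) = x (t + i + q * P)" if "i \<le> q * (A + 1)" for i
    using assms(3)[of i] that q by simp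
  have "3 ^ q dvd q" using three_power_dvd[OF q0] m by blast
  then have "3 ^ q \<le> q" using q0 dvd_imp_le by blast
  then show False using less_exp[of q] power_mono[of 2 "3 :: nat" q] by linarith
qed

end

section \<open>The repetitive threshold\<close>

lemma periodic_not_avoids_above:
  assumes "0 < p" "\<And>t. a (t + p) = a t" "r < 2"
  shows "\<not> avoids_above r a"
proof -
  define u where "u = map a [0..<p]"
  have "map a [p..<p + p] = map (\<lambda>i. a (i + p)) [0..<p]"
    by (rule nth_equalityI) (simp_all add: add.commute)
  then have "map a [0..<p + p] = u @ u"
    using assms(2) by (simp add: u_def upt_add_eq_append[of 0 p p])
  then have "factor_of (u @ u) a"
    unfolding factor_of_def by (intro exI[of _ 0]) (simp add: u_def)
  moreover have "frac_power 2 (u @ u)"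
    using assms(1) by (auto simp: frac_power_def u_def)
  moreover have "real_of_rat 2 = 2" by simp
  ultimately show ?thesis using assms(3) unfolding avoids_above_def by metis
qed

lemma recurrence_not_avoids_above:
  assumes "a i = a j" "i < j" "r < 1 + 1 / real (j - i)"
  shows "\<not> avoids_above r a"
proof -
  define u where "u = map a [i..<j]"
  define s :: rat where "s = 1 + 1 / rat_of_nat (j - i)"
  have "map a [i..<Suc j] = u @ [a j]" using assms(2) by (simp add: u_def)
  then have "factor_of (u @ [a j]) a"
    using assms(2) unfolding factor_of_def by (intro exI[of _ i]) (simp add: u_def)
  moreover have "prefix [a j] u" using assms(1,2) by (simp add: u_def upt_conv_Cons)
  then have "frac_power s (u @ [a j])"
    unfolding frac_power_def using assms(2)
    by (intro conjI exI[of _ u] exI[of _ "[a j]"]) (auto simp: s_def u_def)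
  moreover have "real_of_rat s = 1 + 1 / real (j - i)"
    by (simp add: s_def of_rat_add of_rat_divide)
  ultimately show ?thesis using assms(3) unfolding avoids_above_def by metis
qed

lemma RT_set_ge:
  assumes n: "2 \<le> n" and r: "r \<in> RT_set n"
  shows "real n / (real n - 1) \<le> r"
proof (rule ccontr)
  assume "\<not> ?thesis"
  then have less: "r < 1 + 1 / (real n - 1)" using n by (simp add: field_simps)
  obtain a :: "nat \<Rightarrow> nat" where a: "range a \<subseteq> {..<n}" "avoids_above r a"
    using r unfolding RT_set_def by blast
  have distinct: "a i \<noteq> a j" if "i < j" "j < i + n" for i j
  proof
    assume eq: "a i = a j"
    have "real (j - i) \<le> real n - 1" using that by linarith
    then have "1 / (real n - 1) \<le> 1 / real (j - i)" using that by (intro divide_left_mono) auto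
    then show False using recurrence_not_avoids_above[OF eq that(1)] less a(2) by force
  qed
  \<comment> \<open>The \<open>n\<close> positions after \<open>t\<close> carry all letters, and
    among them only \<open>t + n\<close> can repeat the letter at \<open>t\<close>.\<close>
  have "a (t + n) = a t" for t
  proof -
    have inj: "inj_on a {t + 1..<t + 1 + n}"
      by (rule linorder_inj_onI) (use distinct in auto)
    have "a ` {t + 1..<t + 1 + n} = {..<n}"
      by (rule card_subset_eq) (use a(1) card_image[OF inj] in auto)
    then have "a t \<in> a ` {t + 1..<t + 1 + n}" using a(1) by blast
    then obtain j where j: "j \<in> {t + 1..<t + 1 + n}" "a t = a j" by (rule imageE)
    then have "\<not> (t < j \<and> j < t + n)" using distinct[of t j] by blast
    then have "j = t + n" using j(1) by auto
    then show ?thesis using j(2) by simp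
  qed
  moreover have "1 / (real n - 1) \<le> 1" using n by simp
  then have "r < 2" using less by linarith
  ultimately show False using periodic_not_avoids_above[of n a r] a(2) n by simp
qed

text \<open>A factor of period \<open>p\<close> and excess \<open>k\<close> has exponent
  \<open>1 + k / p\<close>, which exceeds \<open>n / (n - 1)\<close> exactly if
  \<open>p < k * (n - 1)\<close>.\<close>

lemma RT_set_memI:
  fixes a :: "nat \<Rightarrow> nat"
  assumes n: "2 \<le> n" and range: "range a \<subseteq> {..<n}"
    and sparse: "\<And>t p k. 0 < p \<Longrightarrow> p < k * (n - 1) \<Longrightarrow> \<forall>i<k. a (t + i) = a (t + i + p) \<Longrightarrow> False"
  shows "real n / (real n - 1) \<in> RT_set n"
proof -
  have "avoids_above (real n / (real n - 1)) a"
    unfolding avoids_above_def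
  proof clarify
    fix w and s :: rat
    assume w: "factor_of w a" "frac_power s w" and s: "real n / (real n - 1) < real_of_rat s"
    obtain t where t: "w = map a [t..<t + length w]" using w(1) by (auto simp: factor_of_def)
    obtain u v where uv: "w = u @ v" "prefix v u"
        "rat_of_nat (length v) = (s - 1) * rat_of_nat (length u)" "w \<noteq> []"
      using w(2) by (auto simp: frac_power_def)
    define p k where "p = length u" and "k = length v"
    have p: "0 < p" using uv by (auto simp: p_def)
    have "real_of_rat (rat_of_nat k) = real_of_rat ((s - 1) * rat_of_nat p)"
      using uv(3) by (simp add: p_def k_def)
    then have k: "real k = (real_of_rat s - 1) * real p"
      by (simp add: of_rat_mult of_rat_diff)
    have "1 < (real_of_rat s - 1) * (real n - 1)" using s n by (simp add: field_simps)
    then have "real p * 1 < real p * ((real_of_rat s - 1) * (real n - 1))"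
      using p by (intro mult_strict_left_mono) auto
    then have "real p < real k * (real n - 1)" by (simp add: k mult_ac)
    then have "real p < real (k * (n - 1))" using n by (simp add: of_nat_diff)
    then have pk: "p < k * (n - 1)" by (simp only: of_nat_less_iff)
    have kp: "k \<le> p" using uv(2) by (simp add: p_def k_def prefix_length_le)
    have nth: "w ! i = a (t + i)" if "i < p + k" for i
      using that t uv(1) by (metis add.commute diff_add_inverse2 length_append nth_map_upt p_def k_def)
    have "a (t + i) = a (t + i + p)" if "i < k" for i
    proof -
      have "u ! i = v ! i" using uv(2) that by (auto simp: prefix_def nth_append k_def)
      then have "w ! i = w ! (p + i)" using that kp by (simp add: uv(1) nth_append p_def k_def)
      then show ?thesis using nth[of i] nth[of "p + i"] that by (simp add: ac_simps)
    qed
    then show False using sparse[OF p pk] by blast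
  qed
  then show ?thesis using range by (auto simp: RT_set_def)
qed

theorem mainTheorem1:
  fixes n :: nat
  assumes "n \<ge> 27"
  shows "RT n = real n / (real n - 1)"
proof -
  interpret dejean n by unfold_locales (fact assms)
  have n: "2 \<le> n" using assms by simp
  have "real n / (real n - 1) \<in> RT_set n"
  proof (rule RT_set_memI[OF n])
    show "range x \<subseteq> {..<n}" using x_less by auto
    show False if "0 < p" "p < k * (n - 1)" "\<forall>i<k. x (t + i) = x (t + i + p)" for t p k
      using x_avoids[OF that(1,2)] that(3) by blast
  qed
  then show ?thesis
    unfolding RT_def using RT_set_ge[OF n] by (intro cInf_eq_minimum)
qed

end
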